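(* Let $q\in(0,1)$ and let $u_0:\mathbb{R}\to\mathbb{R}$ be given by $$u_0(x)=\begin{cases}\frac12 q\left(1+\frac{1-q^4}{2}x\right), & x\in\left[-\frac{2}{1-q^4},0\right],\\ k_jx+d_j, & x\in[x_j,x_{j+1}],\ j\in\mathbb{N}=\{0,1,2,\dots\},\\ 0, & \text{otherwise},\end{cases}$$ where the endpoints of the intervals $[x_j,x_{j+1}]$ are defined inductively by $$x_0=0,\qquad x_{2j+2}-x_{2j+1}=x_{2j+1}-x_{2j}=q^{4j}\quad (j\in\mathbb{N}),$$ and the constants $k_j$, $d_j$ are, for $j\in\mathbb{N}$, $$k_{2j}=-\frac{1}{q^{j-1}},\qquad k_{2j+1}=\frac12\,\frac{q+q^4}{q^j},$$ $$d_{2j}=\frac12\,\frac{1}{q^{j-1}(1-q^4)}\left(4-3q^{4j}-q^{4(j+1)}\right),$$ $$d_{2j+1}=-\frac12\,\frac{1}{q^{j-1}(1-q^4)}\left(2+2q^3-q^{4j+3}-2q^{4j+4}-q^{4j+7}\right).$$ Let $u(t,x)$ be the conservative solution of the Camassa--Holm equation with initial data $u(0,x)=u_0(x)$ and initial energy measure $\mu_0=u_{0,x}^2\,dx$. Then $t=0$ is an accumulation point of breaking times of $u$, i.e. for every $\varepsilon>0$ there is a breaking time $t$ with $0<|t|<\varepsilon$.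
   Context: The Camassa--Holm (CH) equation is $u_t-u_{txx}+3uu_x-2u_xu_{xx}-uu_{xxx}=0$. Its conservative solutions are defined as follows. Eulerian coordinates: $\mathcal{D}$ is the set of pairs $(u,\mu)$ with $u\in H^1(\mathbb{R})$ and $\mu$ a positive finite Radon measure on $\mathbb{R}$ whose absolutely continuous part is $u_x^2\,dx$. Lagrangian coordinates: $\mathcal{F}$ is the set of triples $X=(\zeta,U,h)$ (also written $(y,U,h)$, with $y(\xi)=\zeta(\xi)+\xi$) such that: $\zeta\in L^\infty(\mathbb{R})$ and $U,h,\zeta_\xi,U_\xi\in L^\infty(\mathbb{R})\cap L^2(\mathbb{R})$; $y_\xi\ge0$, $h\ge0$, $y_\xi+h>0$ a.e.; $y_\xi h=U_\xi^2$ a.e.; and $y+H\in G$, where $H(\xi)=\int_{-\infty}^\xi h(\eta)\,d\eta$ and $G$ is the group of homeomorphisms $f$ of $\mathbb{R}$ with $f-\mathrm{Id},\,f^{-1}-\mathrm{Id}\in W^{1,\infty}(\mathbb{R})$ and $f_\xi-1\in L^2(\mathbb{R})$. Initial Lagrangian data: to $(u_0,\mu_0)\in\mathcal{D}$ one associates $(y_0,U_0,h_0)\in\mathcal{F}$ by $$y_0(\xi)=\sup\{y\mid \mu_0((-\infty,y))+y<\xi\},\qquad h_0(\xi)=1-y_{0,\xi}(\xi),\qquad U_0(\xi)=u_0(y_0(\xi)).$$ Evolution: $X(t)=(\zeta,U,h)(t)$ is the unique global solution in $\mathcal{F}$ (forward and backward in time) with this initial data of $$\zeta_t=U,\quad \zeta_{\xi,t}=U_\xi,\quad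 U_t=-Q,\quad U_{\xi,t}=\tfrac12h+(U^2-P)y_\xi,\quad h_t=2(U^2-P)U_\xi,$$ where $$P(t,\xi)=\tfrac14\int_{\mathbb{R}}e^{-|y(t,\xi)-y(t,\eta)|}(2U^2y_\xi+h)(t,\eta)\,d\eta,$$ $$Q(t,\xi)=-\tfrac14\int_{\mathbb{R}}\mathrm{sign}(\xi-\eta)e^{-|y(t,\xi)-y(t,\eta)|}(2U^2y_\xi+h)(t,\eta)\,d\eta.$$ The conservative solution $(u(t),\mu(t))\in\mathcal{D}$ is then given by $u(t,x)=U(t,\xi)$ for any $\xi$ with $x=y(t,\xi)$, and $\mu(t)=y(t,\cdot)_\#(h(t,\xi)\,d\xi)$. Breaking times: for every $\xi$ at which $y_0$ and $U_0$ are differentiable (almost every $\xi$), the values $(y_\xi,U_\xi,h)(t,\xi)$ are understood pointwise as the solution in $t$ of the linear ODE system $y_{\xi,t}=U_\xi$, $U_{\xi,t}=\frac12h+(U^2-P)y_\xi$, $h_t=2(U^2-P)U_\xi$ with initial values $(y_{0,\xi},U_{0,\xi},h_0)(\xi)$. Wave breaking occurs at time $t$ at such a point $\xi$ if $y_\xi(t,\xi)=0$ (equivalently $\frac{h}{y_\xi+h}(t,\xi)=1$). A time $t$ is a breaking time of the solution if wave breaking occurs at time $t$ at some such $\xi$. *)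

theory Defs
  imports "HOL-Analysis.Analysis" "HOL-Probability.Essential_Supremum"
begin

section \<open>Function spaces on the real line\<close>

definition test_function :: "(real \<Rightarrow> real) \<Rightarrow> bool" where
  "test_function \<phi> \<longleftrightarrow>
     (\<forall>n x. (deriv ^^ n) \<phi> field_differentiable at x) \<and> compact (closure {x. \<phi> x \<noteq> 0})"

definition locally_integrable :: "(real \<Rightarrow> real) \<Rightarrow> bool" where
  "locally_integrable f \<longleftrightarrow> (\<forall>a b. set_integrable lborel {a..b} f)"

definition weak_deriv :: "(real \<Rightarrow> real) \<Rightarrow> (real \<Rightarrow> real) \<Rightarrow> bool" where
  "weak_deriv f g \<longleftrightarrow> locally_integrable f \<and> locally_integrable g \<and>
     (\<forall>\<phi>. test_function \<phi> \<longrightarrow>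
        (LINT x|lborel. f x * deriv \<phi> x) = - (LINT x|lborel. g x * \<phi> x))"

text \<open>Weakly differentiable functions are always taken in their continuous version, because
  they are evaluated pointwise and composed.\<close>

definition weakly_differentiable :: "(real \<Rightarrow> real) \<Rightarrow> bool" where
  "weakly_differentiable f \<longleftrightarrow> continuous_on UNIV f \<and> (\<exists>g. weak_deriv f g)"

text \<open>A representative of the weak derivative, which is determined up to null sets; it is used
  below only in ways that do not depend on the representative.\<close>

definition wderiv :: "(real \<Rightarrow> real) \<Rightarrow> real \<Rightarrow> real" where
  "wderiv f = (SOME g. weak_deriv f g)"

definition Linf_norm :: "(real \<Rightarrow> real) \<Rightarrow> ennreal" where
  "Linf_norm f = esssup lborel (\<lambda>x. ennreal \<bar>f x\<bar>)"

definition L2_norm_sq :: "(real \<Rightarrow> real) \<Rightarrow> ennreal" where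
  "L2_norm_sq f = (\<integral>\<^sup>+ x. ennreal ((f x)\<^sup>2) \<partial>lborel)"

definition Linf :: "(real \<Rightarrow> real) set" where
  "Linf = {f \<in> borel_measurable lborel. Linf_norm f < \<infinity>}"

definition L2 :: "(real \<Rightarrow> real) set" where
  "L2 = {f \<in> borel_measurable lborel. L2_norm_sq f < \<infinity>}"

definition H1 :: "(real \<Rightarrow> real) set" where
  "H1 = {f. weakly_differentiable f \<and> f \<in> L2 \<and> wderiv f \<in> L2}"

definition W1inf :: "(real \<Rightarrow> real) set" where
  "W1inf = {f. weakly_differentiable f \<and> f \<in> Linf \<and> wderiv f \<in> Linf}"

section \<open>Eulerian and Lagrangian coordinates\<close>

text \<open>The measure \<open>\<nu>\<close> below is the singular part of \<open>\<mu>\<close> in its Lebesgue decomposition.\<close>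

definition calD :: "((real \<Rightarrow> real) \<times> real measure) set" where
  "calD = {(u, \<mu>). u \<in> H1 \<and> sets \<mu> = sets borel \<and> finite_measure \<mu> \<and>
     (\<exists>\<nu> N. sets \<nu> = sets borel \<and> N \<in> null_sets lborel \<and> emeasure \<nu> (UNIV - N) = 0 \<and>
        (\<forall>A \<in> sets borel.
           emeasure \<mu> A = emeasure (density lborel (\<lambda>x. ennreal ((wderiv u x)\<^sup>2))) A + emeasure \<nu> A))}"

definition calG :: "(real \<Rightarrow> real) set" where
  "calG = {f. \<exists>g. homeomorphism UNIV UNIV f g \<and>
     (\<lambda>x. f x - x) \<in> W1inf \<and> (\<lambda>x. g x - x) \<in> W1inf \<and> (\<lambda>x. wderiv f x - 1) \<in> L2}"

definition chr :: "(real \<Rightarrow> real) \<Rightarrow> real \<Rightarrow> real" where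
  "chr \<zeta> \<xi> = \<zeta> \<xi> + \<xi>"

definition chr_x :: "(real \<Rightarrow> real) \<Rightarrow> real \<Rightarrow> real" where
  "chr_x \<zeta> \<xi> = wderiv \<zeta> \<xi> + 1"

definition calF :: "((real \<Rightarrow> real) \<times> (real \<Rightarrow> real) \<times> (real \<Rightarrow> real)) set" where
  "calF = {(\<zeta>, U, h).
     weakly_differentiable \<zeta> \<and> weakly_differentiable U \<and>
     \<zeta> \<in> Linf \<and> U \<in> Linf \<inter> L2 \<and> h \<in> Linf \<inter> L2 \<and> wderiv \<zeta> \<in> Linf \<inter> L2 \<and> wderiv U \<in> Linf \<inter> L2 \<and>
     (AE \<xi> in lborel. chr_x \<zeta> \<xi> \<ge> 0 \<and> h \<xi> \<ge> 0 \<and> chr_x \<zeta> \<xi> + h \<xi> > 0) \<and>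
     (AE \<xi> in lborel. chr_x \<zeta> \<xi> * h \<xi> = (wderiv U \<xi>)\<^sup>2) \<and>
     (\<lambda>\<xi>. chr \<zeta> \<xi> + (LINT \<eta>:{..\<xi>}|lborel. h \<eta>)) \<in> calG}"

definition init_y :: "real measure \<Rightarrow> real \<Rightarrow> real" where
  "init_y \<mu>0 \<xi> = Sup {y. measure \<mu>0 {..<y} + y < \<xi>}"

definition init_U :: "(real \<Rightarrow> real) \<Rightarrow> real measure \<Rightarrow> real \<Rightarrow> real" where
  "init_U u0 \<mu>0 \<xi> = u0 (init_y \<mu>0 \<xi>)"

definition init_h :: "real measure \<Rightarrow> real \<Rightarrow> real" where
  "init_h \<mu>0 \<xi> = 1 - deriv (init_y \<mu>0) \<xi>"

section \<open>Evolution and conservative solutions\<close>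

definition P_op :: "(real \<Rightarrow> real) \<Rightarrow> (real \<Rightarrow> real) \<Rightarrow> (real \<Rightarrow> real) \<Rightarrow> real \<Rightarrow> real" where
  "P_op \<zeta> U h \<xi> = 1/4 * (LINT \<eta>|lborel.
     exp (- \<bar>chr \<zeta> \<xi> - chr \<zeta> \<eta>\<bar>) * (2 * (U \<eta>)\<^sup>2 * chr_x \<zeta> \<eta> + h \<eta>))"

definition Q_op :: "(real \<Rightarrow> real) \<Rightarrow> (real \<Rightarrow> real) \<Rightarrow> (real \<Rightarrow> real) \<Rightarrow> real \<Rightarrow> real" where
  "Q_op \<zeta> U h \<xi> = - 1/4 * (LINT \<eta>|lborel.
     sgn (\<xi> - \<eta>) * exp (- \<bar>chr \<zeta> \<xi> - chr \<zeta> \<eta>\<bar>) * (2 * (U \<eta>)\<^sup>2 * chr_x \<zeta> \<eta> + h \<eta>))"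

text \<open>The evolution is an ordinary differential equation for \<open>(\<zeta>, \<zeta>\<^sub>\<xi>, U, U\<^sub>\<xi>, h)\<close> in the Banach
  space \<open>L\<^sup>\<infinity> \<times> (L\<^sup>\<infinity> \<inter> L\<^sup>2)\<^sup>4\<close>: time derivatives are limits of difference quotients in norm.\<close>

definition has_time_deriv_Linf ::
    "(real \<Rightarrow> real \<Rightarrow> real) \<Rightarrow> (real \<Rightarrow> real) \<Rightarrow> real \<Rightarrow> bool" where
  "has_time_deriv_Linf f D t \<longleftrightarrow>
     ((\<lambda>s. Linf_norm (\<lambda>\<xi>. (f s \<xi> - f t \<xi>) / (s - t) - D \<xi>)) \<longlongrightarrow> 0) (at t)"

definition has_time_deriv_L2 ::
    "(real \<Rightarrow> real \<Rightarrow> real) \<Rightarrow> (real \<Rightarrow> real) \<Rightarrow> real \<Rightarrow> bool" where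
  "has_time_deriv_L2 f D t \<longleftrightarrow>
     ((\<lambda>s. L2_norm_sq (\<lambda>\<xi>. (f s \<xi> - f t \<xi>) / (s - t) - D \<xi>)) \<longlongrightarrow> 0) (at t)"

definition has_time_deriv ::
    "(real \<Rightarrow> real \<Rightarrow> real) \<Rightarrow> (real \<Rightarrow> real) \<Rightarrow> real \<Rightarrow> bool" where
  "has_time_deriv f D t \<longleftrightarrow> has_time_deriv_Linf f D t \<and> has_time_deriv_L2 f D t"

definition lagrangian_solution ::
    "(real \<Rightarrow> real) \<Rightarrow> real measure \<Rightarrow>
     (real \<Rightarrow> real \<Rightarrow> real) \<Rightarrow> (real \<Rightarrow> real \<Rightarrow> real) \<Rightarrow> (real \<Rightarrow> real \<Rightarrow> real) \<Rightarrow> bool" where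
  "lagrangian_solution u0 \<mu>0 \<zeta> U h \<longleftrightarrow>
     (\<forall>\<xi>. chr (\<zeta> 0) \<xi> = init_y \<mu>0 \<xi>) \<and>
     (\<forall>\<xi>. U 0 \<xi> = init_U u0 \<mu>0 \<xi>) \<and>
     (AE \<xi> in lborel. h 0 \<xi> = init_h \<mu>0 \<xi>) \<and>
     (\<forall>t. (\<zeta> t, U t, h t) \<in> calF \<and>
        (let P = P_op (\<zeta> t) (U t) (h t);
             Q = Q_op (\<zeta> t) (U t) (h t);
             y\<^sub>\<xi> = chr_x (\<zeta> t);
             U\<^sub>\<xi> = wderiv (U t)
         in has_time_deriv_Linf \<zeta> (U t) t \<and>
            has_time_deriv (\<lambda>s. wderiv (\<zeta> s)) U\<^sub>\<xi> t \<and>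
            has_time_deriv U (\<lambda>\<xi>. - Q \<xi>) t \<and>
            has_time_deriv (\<lambda>s. wderiv (U s))
              (\<lambda>\<xi>. 1/2 * h t \<xi> + ((U t \<xi>)\<^sup>2 - P \<xi>) * y\<^sub>\<xi> \<xi>) t \<and>
            has_time_deriv h (\<lambda>\<xi>. 2 * ((U t \<xi>)\<^sup>2 - P \<xi>) * U\<^sub>\<xi> \<xi>) t))"

definition conservative_solution ::
    "(real \<Rightarrow> real) \<Rightarrow> real measure \<Rightarrow>
     (real \<Rightarrow> real \<Rightarrow> real) \<Rightarrow> (real \<Rightarrow> real \<Rightarrow> real) \<Rightarrow> (real \<Rightarrow> real \<Rightarrow> real) \<Rightarrow>
     (real \<Rightarrow> real \<Rightarrow> real) \<Rightarrow> (real \<Rightarrow> real measure) \<Rightarrow> bool" where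
  "conservative_solution u0 \<mu>0 \<zeta> U h u \<mu> \<longleftrightarrow>
     (u0, \<mu>0) \<in> calD \<and> lagrangian_solution u0 \<mu>0 \<zeta> U h \<and>
     (\<forall>t. (u t, \<mu> t) \<in> calD \<and>
        (\<forall>\<xi>. u t (chr (\<zeta> t) \<xi>) = U t \<xi>) \<and>
        \<mu> t = distr (density lborel (\<lambda>\<xi>. ennreal (h t \<xi>))) borel (chr (\<zeta> t)))"

section \<open>Wave breaking\<close>

text \<open>\<open>a\<close>, \<open>b\<close>, \<open>c\<close> are the pointwise versions of \<open>y\<^sub>\<xi>\<close>, \<open>U\<^sub>\<xi>\<close>, \<open>h\<close> along the characteristic
  with label \<open>\<xi>\<close>.\<close>

definition pointwise_solution ::
    "(real \<Rightarrow> real) \<Rightarrow> real measure \<Rightarrow>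
     (real \<Rightarrow> real \<Rightarrow> real) \<Rightarrow> (real \<Rightarrow> real \<Rightarrow> real) \<Rightarrow> (real \<Rightarrow> real \<Rightarrow> real) \<Rightarrow> real \<Rightarrow>
     (real \<Rightarrow> real) \<Rightarrow> (real \<Rightarrow> real) \<Rightarrow> (real \<Rightarrow> real) \<Rightarrow> bool" where
  "pointwise_solution u0 \<mu>0 \<zeta> U h \<xi> a b c \<longleftrightarrow>
     a 0 = deriv (init_y \<mu>0) \<xi> \<and> b 0 = deriv (init_U u0 \<mu>0) \<xi> \<and> c 0 = init_h \<mu>0 \<xi> \<and>
     (\<forall>s. let K = (U s \<xi>)\<^sup>2 - P_op (\<zeta> s) (U s) (h s) \<xi> in
        (a has_real_derivative b s) (at s) \<and>
        (b has_real_derivative (1/2 * c s + K * a s)) (at s) \<and>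
        (c has_real_derivative (2 * K * b s)) (at s))"

definition breaking_time ::
    "(real \<Rightarrow> real) \<Rightarrow> real measure \<Rightarrow>
     (real \<Rightarrow> real \<Rightarrow> real) \<Rightarrow> (real \<Rightarrow> real \<Rightarrow> real) \<Rightarrow> (real \<Rightarrow> real \<Rightarrow> real) \<Rightarrow> real \<Rightarrow> bool" where
  "breaking_time u0 \<mu>0 \<zeta> U h t \<longleftrightarrow>
     (\<exists>\<xi>. init_y \<mu>0 field_differentiable at \<xi> \<and> init_U u0 \<mu>0 field_differentiable at \<xi> \<and>
        (\<exists>a b c. pointwise_solution u0 \<mu>0 \<zeta> U h \<xi> a b c \<and> a t = 0))"

section \<open>The initial datum\<close>

fun node :: "real \<Rightarrow> nat \<Rightarrow> real" where
  "node q 0 = 0"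
| "node q (Suc n) = node q n + q ^ (4 * (n div 2))"

definition slope :: "real \<Rightarrow> nat \<Rightarrow> real" where
  "slope q n = (let j = n div 2 in
     if even n then - 1 / q powi (int j - 1) else 1/2 * ((q + q ^ 4) / q ^ j))"

definition intercept :: "real \<Rightarrow> nat \<Rightarrow> real" where
  "intercept q n = (let j = n div 2 in
     if even n
     then 1/2 * (1 / (q powi (int j - 1) * (1 - q ^ 4))) * (4 - 3 * q ^ (4 * j) - q ^ (4 * (j + 1)))
     else - 1/2 * (1 / (q powi (int j - 1) * (1 - q ^ 4))) *
       (2 + 2 * q ^ 3 - q ^ (4 * j + 3) - 2 * q ^ (4 * j + 4) - q ^ (4 * j + 7)))"

text \<open>\<open>LEAST\<close> selects a piece at the common endpoints; \<open>profile_piece\<close> shows that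
  the choice is immaterial.\<close>

definition profile :: "real \<Rightarrow> real \<Rightarrow> real" where
  "profile q x =
     (if x \<in> {- 2 / (1 - q ^ 4)..0} then 1/2 * q * (1 + (1 - q ^ 4) / 2 * x)
      else if \<exists>j. x \<in> {node q j..node q (Suc j)} then
        (let j = (LEAST j. x \<in> {node q j..node q (Suc j)}) in slope q j * x + intercept q j)
      else 0)"

lemma node_even_odd:
  assumes "0 < q" "q < 1"
  shows "node q (2 * j) = 2 * (1 - q ^ (4 * j)) / (1 - q ^ 4)"
    and "node q (2 * j + 1) = (2 - q ^ (4 * j) - q ^ (4 * j + 4)) / (1 - q ^ 4)"
proof -
  have n: "1 - q ^ 4 \<noteq> 0" using assms power_less_one_iff[of q 4] by auto
  show A: "node q (2 * j) = 2 * (1 - q ^ (4 * j)) / (1 - q ^ 4)"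
  proof -
    have "node q (2 * j) * (1 - q ^ 4) = 2 * (1 - q ^ (4 * j))"
      by (induction j) (simp_all add: distrib_right, simp add: algebra_simps power_add)
    then show ?thesis using n by (simp add: eq_divide_eq)
  qed
  show "node q (2 * j + 1) = (2 - q ^ (4 * j) - q ^ (4 * j + 4)) / (1 - q ^ 4)"
    using A n by (simp add: field_simps power_add)
qed

lemma slope_intercept_match:
  assumes "0 < q" "q < 1"
  shows "slope q n * node q (Suc n) + intercept q n =
    slope q (Suc n) * node q (Suc n) + intercept q (Suc n)"
proof -
  have n: "1 - q ^ 4 \<noteq> 0" and q: "q \<noteq> 0" using assms power_less_one_iff[of q 4] by auto
  show ?thesis
  proof (cases "even n")
    case True
    then obtain j where j: "n = 2 * j" by auto
    have d: "Suc (2 * j) div 2 = j" by simp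
    have pw: "q powi (int j - 1) = q ^ j / q" using q by (simp add: power_int_diff)
    have x: "node q (Suc (2 * j)) = (2 - q ^ (4 * j) - q ^ (4 * j + 4)) / (1 - q ^ 4)"
      using node_even_odd(2)[OF assms, of j] by simp
    show ?thesis
      unfolding j slope_def intercept_def Let_def x d pw using n q
      apply (simp add: divide_simps pw power_add)
      apply (simp add: algebra_simps power_numeral_reduce)
      done
  next
    case False
    then obtain j where j: "n = 2 * j + 1" by (rule oddE)
    have d: "(2 * j + 1) div 2 = j" "Suc (2 * j + 1) div 2 = j + 1" by simp_all
    have pw: "q powi (int j - 1) = q ^ j / q" using q by (simp add: power_int_diff)
    have pw1: "q powi (int (j + 1) - 1) = q ^ j" using q by simp
    have x: "node q (Suc (2 * j + 1)) = 2 * (1 - q ^ (4 * (j + 1))) / (1 - q ^ 4)"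
      using node_even_odd(1)[OF assms, of "j + 1"] by simp
    show ?thesis
      unfolding j slope_def intercept_def Let_def x d pw pw1 using n q
      apply (simp add: divide_simps pw power_add)
      apply (simp add: algebra_simps power_numeral_reduce)
      done
  qed
qed

lemma strict_mono_node: "0 < q \<Longrightarrow> strict_mono (node q)"
  by (simp add: strict_mono_Suc_iff)

lemma profile_piece:
  assumes "0 < q" "q < 1" and x: "x \<in> {node q j..node q (Suc j)}"
  shows "profile q x = slope q j * x + intercept q j"
proof -
  have sm: "strict_mono (node q)" using assms(1) by (rule strict_mono_node)
  define i where "i = (LEAST j. x \<in> {node q j..node q (Suc j)})"
  have i: "x \<in> {node q i..node q (Suc i)}" unfolding i_def by (rule LeastI[of _ j]) (rule x)
  have "i \<le> j" unfolding i_def by (rule Least_le) (rule x)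
  have eq: "slope q i * x + intercept q i = slope q j * x + intercept q j"
  proof (cases "i = j")
    case False
    with \<open>i \<le> j\<close> have "Suc i \<le> j" by simp
    then have "node q (Suc i) \<le> node q j"
      using sm strict_mono_less_eq by blast
    then have xe: "x = node q (Suc i)" "node q (Suc i) = node q j" using i x by auto
    then have "j = Suc i" using sm strict_mono_eq by metis
    then show ?thesis using slope_intercept_match[OF assms(1,2), of i] xe by simp
  qed simp
  have "0 \<le> x" using x strict_mono_less_eq[OF sm, of 0 j] by auto
  show ?thesis
  proof (cases "x = 0")
    case True
    then have "node q j \<le> node q 0" using x by simp
    then have "j = 0" using strict_mono_less_eq[OF sm, of j 0] by simp
    moreover have "1 - q ^ 4 > 0" using assms power_less_one_iff[of q 4] by simp
    ultimately show ?thesis using True assms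
      by (simp add: profile_def slope_def intercept_def power_int_minus field_simps)
  next
    case False
    with \<open>0 \<le> x\<close> have "x \<notin> {- 2 / (1 - q ^ 4)..0}" by auto
    then show ?thesis using x eq unfolding profile_def i_def[symmetric] Let_def by auto
  qed
qed

text \<open>The measure \<open>u\<^sub>x\<^sup>2 dx\<close> of a piecewise linear \<open>u\<close>, which has a classical derivative off a
  countable set.\<close>

definition energy_measure :: "(real \<Rightarrow> real) \<Rightarrow> real measure" where
  "energy_measure u = density lborel (\<lambda>x. ennreal ((deriv u x)\<^sup>2))"

end

theory Submission
  imports Defs
begin

text \<open>
  Along a characteristic with label \<open>\<xi>\<close> the triple \<open>(y\<^sub>\<xi>, U\<^sub>\<xi>, h)\<close> satisfies a linear system whose only
  coefficient is the potential \<open>K = U\<^sup>2 - P\<close>. Its initial value lies on the cone \<open>y\<^sub>\<xi> h = U\<^sub>\<xi>\<^sup>2\<close>, which the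
  flow preserves and which is parametrised by \<open>(p\<^sup>2, p r, r\<^sup>2)\<close>; in these parameters the system is
  \<open>p' = r / 2\<close>, \<open>r' = K p\<close>, that is, the scalar equation \<open>p'' = (K / 2) p\<close>. So wave breaking at
  \<open>\<xi>\<close> is exactly a zero of \<open>p\<close>.

  Where \<open>u\<^sub>0\<close> has slope \<open>k\<close>, one has \<open>y\<^sub>0\<^sub>\<xi> = 1 / (1 + k\<^sup>2)\<close> and \<open>U\<^sub>0\<^sub>\<xi> = k / (1 + k\<^sup>2)\<close>, hence
  \<open>r(0) = k p(0)\<close>. If \<open>K\<close> is bounded above by \<open>2 \<kappa>\<^sup>2\<close> near time zero, a comparison with the
  solution \<open>exp (\<kappa> t)\<close> of \<open>\<phi>'' = \<kappa>\<^sup>2 \<phi>\<close> forces \<open>p\<close> to vanish by the time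
  \<open>2 exp (2 \<kappa>) / \<bar>k\<bar>\<close> when \<open>k < 0\<close>, as long as that time is at most one and \<open>K\<close> is so bounded until
  then (\<open>oscillator_has_early_zero\<close>). The bound on \<open>K\<close> can be chosen
  independent of \<open>\<xi>\<close>: \<open>P \<ge> 0\<close>, so \<open>K \<le> U\<^sup>2\<close>, and \<open>U\<close> moves Lipschitz continuously in the
  supremum norm (\<open>potential_locally_bounded_above\<close>). The profile has pieces of positive length with
  slope \<open>-q / q\<^sup>j\<close> for every \<open>j\<close>, so the breaking times so obtained are positive and tend to zero.

  The pointwise solution has to exist for all times, not only up to breaking. The linear system
  has a global solution by Picard iteration as soon as \<open>K\<close> is continuous in time for the fixed label
  (\<open>potential_continuous_in_time\<close>). The density \<open>2 U\<^sup>2 y\<^sub>\<xi> + h\<close> in \<open>P\<close> contains \<open>h\<close> linearly, while the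
  evolution controls \<open>h\<close> only in \<open>L\<^sup>2\<close> and \<open>L\<^sup>\<infinity>\<close>; but \<open>y\<^sub>\<xi> h = U\<^sub>\<xi>\<^sup>2\<close> rewrites \<open>h\<close> as \<open>U\<^sub>\<xi>\<^sup>2 - \<zeta>\<^sub>\<xi> h\<close>, a sum of products
  of \<open>L\<^sup>2\<close> functions, and this makes the density continuous in time with values in \<open>L\<^sup>1\<close>.
\<close>

section \<open>The scalar equation behind the breaking system\<close>

lemma continuous_has_antiderivative:
  fixes f :: "real \<Rightarrow> real"
  assumes "continuous_on UNIV f"
  obtains F where "F 0 = 0" "\<And>x. (F has_real_derivative f x) (at x)"
proof -
  have "isCont f x" for x
    using assms by (simp add: continuous_on_eq_continuous_at)
  then obtain G where G: "\<And>x. (G has_vector_derivative f x) (at x)"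
    using einterval_antiderivative[of "-\<infinity>" "\<infinity>" f] by auto
  show ?thesis
  proof (rule that[of "\<lambda>x. G x - G 0"])
    show "((\<lambda>x. G x - G 0) has_real_derivative f x) (at x)" for x
      using G[of x] unfolding has_real_derivative_iff_has_vector_derivative[symmetric]
      by (auto intro!: derivative_eq_intros)
  qed simp
qed

text \<open>Integrating a bound \<open>B x\<^sup>n\<close> gains the factor \<open>1 / (n + 1)\<close>; iterated, these factors are the
  factorials that make the Picard series converge on every bounded interval.\<close>

lemma antiderivative_power_bound_nonneg:
  fixes F f :: "real \<Rightarrow> real"
  assumes "F 0 = 0" and der: "\<And>x. (F has_real_derivative f x) (at x)"
    and bound: "\<And>x. 0 \<le> x \<Longrightarrow> x \<le> T \<Longrightarrow> \<bar>f x\<bar> \<le> B * x ^ n"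
    and t: "0 \<le> t" "t \<le> T"
  shows "\<bar>F t\<bar> \<le> B * t ^ Suc n / Suc n"
proof -
  have d: "((\<lambda>x. B * x ^ Suc n / Suc n + \<sigma> * F x) has_real_derivative B * x ^ n + \<sigma> * f x) (at x)"
    for x \<sigma>
    by (rule derivative_eq_intros der refl | simp)+
  have "B * 0 ^ Suc n / Suc n + \<sigma> * F 0 \<le> B * t ^ Suc n / Suc n + \<sigma> * F t" if "\<bar>\<sigma>\<bar> = 1" for \<sigma>
  proof (rule DERIV_nonneg_imp_nondecreasing[OF t(1)])
    fix x assume x: "0 \<le> x" "x \<le> t"
    have "\<bar>\<sigma> * f x\<bar> \<le> B * x ^ n"
      using bound[of x] x t that by (simp add: abs_mult)
    then show "\<exists>y. ((\<lambda>x. B * x ^ Suc n / Suc n + \<sigma> * F x) has_real_derivative y) (at x) \<and> 0 \<le> y"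
      using d by (intro exI[of _ "B * x ^ n + \<sigma> * f x"]) (auto simp: abs_le_iff)
  qed
  from this[of 1] this[of "-1"] show ?thesis using assms(1) by (simp add: abs_le_iff)
qed

lemma antiderivative_power_bound:
  fixes F f :: "real \<Rightarrow> real"
  assumes F0: "F 0 = 0" and der: "\<And>x. (F has_real_derivative f x) (at x)"
    and bound: "\<And>x. \<bar>x\<bar> \<le> T \<Longrightarrow> \<bar>f x\<bar> \<le> B * \<bar>x\<bar> ^ n"
    and t: "\<bar>t\<bar> \<le> T"
  shows "\<bar>F t\<bar> \<le> B * \<bar>t\<bar> ^ Suc n / Suc n"
proof (cases "0 \<le> t")
  case True
  have "\<bar>F t\<bar> \<le> B * t ^ Suc n / Suc n"
  proof (rule antiderivative_power_bound_nonneg[of F f T, OF F0 der])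
    show "\<bar>f x\<bar> \<le> B * x ^ n" if "0 \<le> x" "x \<le> T" for x
      using bound[of x] that by simp
  qed (use t True in auto)
  with True show ?thesis by simp
next
  case False
  have der': "((\<lambda>x. - F (- x)) has_real_derivative f (- x)) (at x)" for x
    by (rule derivative_eq_intros refl DERIV_chain2[of F, OF der] | simp)+
  have "\<bar>- F (- (- t))\<bar> \<le> B * (- t) ^ Suc n / Suc n"
  proof (rule antiderivative_power_bound_nonneg[of "\<lambda>x. - F (- x)" "\<lambda>x. f (- x)" T])
    show "\<bar>f (- x)\<bar> \<le> B * x ^ n" if "0 \<le> x" "x \<le> T" for x
      using bound[of "- x"] that by simp
  qed (use F0 der' t False in auto)
  with False show ?thesis by simp
qed

text \<open>The solution is the series of Picard iterates. On \<open>[-T, T]\<close> the \<open>n\<close>-th term is at most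
  \<open>C (M T)\<^sup>n / n!\<close>, so the series may be differentiated term by term there; since the iterates
  do not depend on \<open>T\<close>, the sum is a solution on the whole line.\<close>

lemma linear_oscillator_solution:
  fixes K :: "real \<Rightarrow> real" and p0 r0 :: real
  assumes K: "continuous_on UNIV K"
  shows "\<exists>p r. p 0 = p0 \<and> r 0 = r0 \<and> (\<forall>t. (p has_real_derivative r t / 2) (at t)) \<and>
    (\<forall>t. (r has_real_derivative K t * p t) (at t))"
proof -
  have "\<exists>F. F 0 = 0 \<and> (\<forall>x. (F has_real_derivative f x) (at x))" if "continuous_on UNIV f"
    for f :: "real \<Rightarrow> real"
    using continuous_has_antiderivative[OF that] by blast
  then obtain prim :: "(real \<Rightarrow> real) \<Rightarrow> real \<Rightarrow> real"
    where prim0: "\<And>f. continuous_on UNIV f \<Longrightarrow> prim f 0 = 0"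
      and prim: "\<And>f x. continuous_on UNIV f \<Longrightarrow> (prim f has_real_derivative f x) (at x)"
    by metis
  define X where "X = rec_nat ((\<lambda>_. p0), (\<lambda>_. r0))
    (\<lambda>_ (P, R). (prim (\<lambda>t. R t / 2), prim (\<lambda>t. K t * P t)))"
  define P where "P n = fst (X n)" for n
  define R where "R n = snd (X n)" for n
  have P_0: "P 0 = (\<lambda>_. p0)" and R_0: "R 0 = (\<lambda>_. r0)"
    by (simp_all add: P_def R_def X_def)
  have P_Suc: "P (Suc n) = prim (\<lambda>t. R n t / 2)" and R_Suc: "R (Suc n) = prim (\<lambda>t. K t * P n t)" for n
    by (simp_all add: P_def R_def X_def split: prod.split)
  have cont: "continuous_on UNIV (P n) \<and> continuous_on UNIV (R n)" for n
  proof (induction n)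
    case 0
    then show ?case by (simp add: P_0 R_0)
  next
    case (Suc n)
    then have "continuous_on UNIV (\<lambda>t. R n t / 2)" "continuous_on UNIV (\<lambda>t. K t * P n t)"
      using K by (auto intro!: continuous_intros)
    then show ?case unfolding P_Suc R_Suc
      by (meson prim DERIV_isCont continuous_at_imp_continuous_on)
  qed
  then have cR: "continuous_on UNIV (\<lambda>t. R n t / 2)" and cP: "continuous_on UNIV (\<lambda>t. K t * P n t)" for n
    using K by (auto intro!: continuous_intros)
  have dP: "(P n has_real_derivative (case n of 0 \<Rightarrow> 0 | Suc m \<Rightarrow> R m t / 2)) (at t)"
    and dR: "(R n has_real_derivative (case n of 0 \<Rightarrow> 0 | Suc m \<Rightarrow> K t * P m t)) (at t)" for n t
    by (cases n; simp add: P_0 R_0 P_Suc R_Suc prim[OF cR] prim[OF cP])+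
  have zero: "P (Suc n) 0 = 0" "R (Suc n) 0 = 0" for n
    by (simp_all add: P_Suc R_Suc prim0[OF cR] prim0[OF cP])
  define p where "p t = (\<Sum>n. P n t)" for t
  define r where "r t = (\<Sum>n. R n t)" for t
  have main: "(p has_real_derivative r t / 2) (at t) \<and> (r has_real_derivative K t * p t) (at t)" for t
  proof -
    define T where "T = \<bar>t\<bar> + 1"
    have "continuous_on {-T..T} K" using K continuous_on_subset by blast
    then have "bounded (K ` {-T..T})"
      by (intro compact_imp_bounded compact_continuous_image) auto
    then obtain M0 where "\<forall>x\<in>{-T..T}. \<bar>K x\<bar> \<le> M0"
      by (auto simp: bounded_iff)
    then have M0: "\<bar>K x\<bar> \<le> M0" if "x \<in> {-T..T}" for x
      using that by blast
    define M where "M = max M0 1"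
    define C where "C = max \<bar>p0\<bar> \<bar>r0\<bar>"
    have M: "\<bar>K x\<bar> \<le> M" if "\<bar>x\<bar> \<le> T" for x
      using M0[of x] that by (simp add: M_def le_max_iff_disj abs_le_iff)
    have M1: "1 \<le> M" by (simp add: M_def)
    have C: "\<bar>p0\<bar> \<le> C" "\<bar>r0\<bar> \<le> C" "0 \<le> C" by (auto simp: C_def)
    have bound: "\<bar>P n x\<bar> \<le> C * M ^ n / fact n * \<bar>x\<bar> ^ n \<and> \<bar>R n x\<bar> \<le> C * M ^ n / fact n * \<bar>x\<bar> ^ n"
      if "\<bar>x\<bar> \<le> T" for n x
      using that
    proof (induction n arbitrary: x)
      case 0
      then show ?case using C by (simp add: P_0 R_0)
    next
      case (Suc n)
      let ?B = "C * M ^ Suc n / fact n"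
      have B: "C * M ^ Suc n / fact (Suc n) * \<bar>x\<bar> ^ Suc n = ?B * \<bar>x\<bar> ^ Suc n / Suc n"
        by (simp add: field_simps)
      have b: "\<bar>a * z\<bar> \<le> ?B * \<bar>s\<bar> ^ n"
        if "\<bar>a\<bar> \<le> M" "\<bar>z\<bar> \<le> C * M ^ n / fact n * \<bar>s\<bar> ^ n" for a z s
      proof -
        have "\<bar>a * z\<bar> \<le> M * (C * M ^ n / fact n * \<bar>s\<bar> ^ n)"
          unfolding abs_mult using that M1 by (intro mult_mono) auto
        also have "\<dots> = ?B * \<bar>s\<bar> ^ n" by (simp add: mult.left_commute)
        finally show ?thesis .
      qed
      have "\<bar>P (Suc n) x\<bar> \<le> ?B * \<bar>x\<bar> ^ Suc n / Suc n"
        unfolding P_Suc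
      proof (rule antiderivative_power_bound[OF prim0[OF cR] prim[OF cR]])
        show "\<bar>R n s / 2\<bar> \<le> ?B * \<bar>s\<bar> ^ n" if "\<bar>s\<bar> \<le> T" for s
          using b[of "1/2" "R n s" s] Suc.IH[OF that] M1 by simp
      qed (rule Suc.prems)
      moreover have "\<bar>R (Suc n) x\<bar> \<le> ?B * \<bar>x\<bar> ^ Suc n / Suc n"
        unfolding R_Suc
      proof (rule antiderivative_power_bound[OF prim0[OF cP] prim[OF cP]])
        show "\<bar>K s * P n s\<bar> \<le> ?B * \<bar>s\<bar> ^ n" if "\<bar>s\<bar> \<le> T" for s
          using b[of "K s" "P n s" s] Suc.IH[OF that] M[OF that] by simp
      qed (rule Suc.prems)
      ultimately show ?case unfolding B by simp
    qed
    define c where "c n = C * ((M * T) ^ n / fact n)" for n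
    have sc: "summable c"
      unfolding c_def by (intro summable_mult) (use summable_exp_generic[of "M * T"] in \<open>simp add: field_simps\<close>)
    have T0: "0 \<le> T" by (simp add: T_def)
    have cb: "\<bar>P n x\<bar> \<le> c n" "\<bar>R n x\<bar> \<le> c n" if "\<bar>x\<bar> \<le> T" for n x
    proof -
      have "C * M ^ n / fact n * \<bar>x\<bar> ^ n \<le> C * M ^ n / fact n * T ^ n"
        using that C M1 by (intro mult_left_mono power_mono) auto
      also have "\<dots> = c n" by (simp add: c_def power_mult_distrib)
      finally show "\<bar>P n x\<bar> \<le> c n" "\<bar>R n x\<bar> \<le> c n" using bound[OF that, of n] by auto
    qed
    have sums: "summable (\<lambda>n. P n x)" "summable (\<lambda>n. R n x)" if "\<bar>x\<bar> \<le> T" for x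
      by (rule summable_comparison_test'[OF sc, of 0]; use cb[OF that] in simp)+
    have sc': "summable (\<lambda>n. case n of 0 \<Rightarrow> 0 | Suc m \<Rightarrow> M * c m)"
      using summable_mult[OF sc, of M] by (subst summable_Suc_iff[symmetric]) simp
    have ulim: "uniformly_convergent_on {-T..T} (\<lambda>n x. \<Sum>i<n. case i of 0 \<Rightarrow> 0 | Suc m \<Rightarrow> a x * Y m x)"
      if "\<And>x. \<bar>x\<bar> \<le> T \<Longrightarrow> \<bar>a x\<bar> \<le> M" "\<And>m x. \<bar>x\<bar> \<le> T \<Longrightarrow> \<bar>Y m x\<bar> \<le> c m" for a Y
    proof -
      have "norm (case i of 0 \<Rightarrow> 0 | Suc m \<Rightarrow> a x * Y m x) \<le> (case i of 0 \<Rightarrow> 0 | Suc m \<Rightarrow> M * c m)"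
        if "x \<in> {-T..T}" for i x
      proof (cases i)
        case (Suc m)
        have "\<bar>x\<bar> \<le> T" using that by auto
        then show ?thesis using Suc \<open>\<And>x. \<bar>x\<bar> \<le> T \<Longrightarrow> \<bar>a x\<bar> \<le> M\<close>[of x]
          \<open>\<And>m x. \<bar>x\<bar> \<le> T \<Longrightarrow> \<bar>Y m x\<bar> \<le> c m\<close>[of x m] M1
          by (simp add: abs_mult mult_mono)
      qed simp
      then have ul: "uniform_limit {-T..T} (\<lambda>n x. \<Sum>i<n. case i of 0 \<Rightarrow> 0 | Suc m \<Rightarrow> a x * Y m x)
          (\<lambda>x. \<Sum>i. case i of 0 \<Rightarrow> 0 | Suc m \<Rightarrow> a x * Y m x) sequentially"
        by (rule Weierstrass_m_test[OF _ sc'])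
      show ?thesis
        unfolding uniformly_convergent_on_def by (rule exI, rule ul)
    qed
    have tint: "t \<in> interior {-T..T}" "\<bar>t\<bar> \<le> T" by (auto simp: T_def)
    have shift: "(\<Sum>n. case n of 0 \<Rightarrow> 0 | Suc m \<Rightarrow> a * Y m) = a * (\<Sum>n. Y n)"
      if "summable Y" for a :: real and Y
    proof -
      have "(\<lambda>n. a * Y n) sums (a * (\<Sum>n. Y n))" using that by (intro sums_mult summable_sums)
      then show ?thesis by (subst sums_unique[symmetric, OF sums_Suc_iff[THEN iffD1]]) auto
    qed
    have z: "0 \<in> {-T..T}" "\<bar>0\<bar> \<le> T" using T0 by auto
    have "(p has_real_derivative (\<Sum>n. case n of 0 \<Rightarrow> 0 | Suc m \<Rightarrow> 1/2 * R m t)) (at t)"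
      unfolding p_def[abs_def]
    proof (rule has_field_derivative_series'(2)[of "{-T..T}"])
      show "(P n has_real_derivative (case n of 0 \<Rightarrow> 0 | Suc m \<Rightarrow> 1/2 * R m x)) (at x within {-T..T})" for n x
        using dP[of n x] by (auto intro: has_field_derivative_at_within split: nat.splits)
      show "uniformly_convergent_on {-T..T} (\<lambda>n x. \<Sum>i<n. case i of 0 \<Rightarrow> 0 | Suc m \<Rightarrow> 1/2 * R m x)"
        using ulim[of "\<lambda>_. 1/2" R] M1 cb by auto
    qed (use tint z sums in auto)
    moreover have "(r has_real_derivative (\<Sum>n. case n of 0 \<Rightarrow> 0 | Suc m \<Rightarrow> K t * P m t)) (at t)"
      unfolding r_def[abs_def]
    proof (rule has_field_derivative_series'(2)[of "{-T..T}"])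
      show "(R n has_real_derivative (case n of 0 \<Rightarrow> 0 | Suc m \<Rightarrow> K x * P m x)) (at x within {-T..T})" for n x
        using dR[of n x] by (auto intro: has_field_derivative_at_within split: nat.splits)
      show "uniformly_convergent_on {-T..T} (\<lambda>n x. \<Sum>i<n. case i of 0 \<Rightarrow> 0 | Suc m \<Rightarrow> K x * P m x)"
        by (rule ulim[OF M cb(1)])
    qed (use tint z sums in auto)
    ultimately show ?thesis
      using shift[OF sums(1)[OF tint(2)]] shift[OF sums(2)[OF tint(2)]]
      by (simp add: p_def r_def)
  qed
  have ini: "p 0 = p0" "r 0 = r0"
    unfolding p_def r_def
    by (subst suminf_finite[of "{0}"]; use zero in \<open>auto simp: P_0 R_0 gr0_conv_Suc\<close>)+
  show ?thesis using ini main by blast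
qed

text \<open>While \<open>p > 0\<close>, the Wronskian \<open>W = p' \<phi> - p \<phi>'\<close> with \<open>\<phi> = exp (\<kappa> t)\<close> decreases, because
  \<open>W' = (K / 2 - \<kappa>\<^sup>2) p \<phi>\<close>. So \<open>(p / \<phi>)' = W / \<phi>\<^sup>2\<close> stays below \<open>(k p(0) / 2) exp (- 2 \<kappa>)\<close> on \<open>[0, 1]\<close>,
  and integrating this brings \<open>p / \<phi>\<close> down to zero at the stated time.\<close>

lemma oscillator_has_early_zero:
  fixes p r K :: "real \<Rightarrow> real"
  assumes p0: "p 0 > 0" and r0: "r 0 = k * p 0" and k: "k < 0"
    and dp: "\<And>t. (p has_real_derivative r t / 2) (at t)"
    and dr: "\<And>t. (r has_real_derivative K t * p t) (at t)"
    and "\<kappa> \<ge> 0" and K: "\<And>t. 0 \<le> t \<Longrightarrow> t \<le> \<delta> \<Longrightarrow> K t \<le> 2 * \<kappa>\<^sup>2"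
    and "\<delta> \<le> 1" and early: "2 * exp (2 * \<kappa>) / \<bar>k\<bar> \<le> \<delta>"
  obtains t where "0 < t" "t \<le> 2 * exp (2 * \<kappa>) / \<bar>k\<bar>" "p t = 0"
proof -
  define \<tau> where "\<tau> = 2 * exp (2 * \<kappa>) / \<bar>k\<bar>"
  have \<tau>: "0 < \<tau>" "\<tau> \<le> \<delta>" "\<tau> \<le> 1" using k early \<open>\<delta> \<le> 1\<close> by (auto simp: \<tau>_def divide_pos_neg)
  have "\<exists>t\<in>{0..\<tau>}. p t \<le> 0"
  proof (rule ccontr)
    assume "\<not> ?thesis"
    then have pos: "\<And>t. 0 \<le> t \<Longrightarrow> t \<le> \<tau> \<Longrightarrow> 0 < p t" by force
    define W where "W t = (r t / 2 - \<kappa> * p t) * exp (\<kappa> * t)" for t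
    have dW: "(W has_real_derivative (K t / 2 - \<kappa>\<^sup>2) * p t * exp (\<kappa> * t)) (at t)" for t
      unfolding W_def[abs_def]
      by (rule derivative_eq_intros dp dr refl | simp)+ (simp add: algebra_simps power2_eq_square)
    have W: "W t \<le> k * p 0 / 2" if t: "0 \<le> t" "t \<le> \<tau>" for t
    proof -
      have "W t \<le> W 0"
      proof (rule DERIV_nonpos_imp_nonincreasing[OF t(1)])
        fix x assume "0 \<le> x" "x \<le> t"
        then have "(K x / 2 - \<kappa>\<^sup>2) * p x * exp (\<kappa> * x) \<le> 0"
          using K[of x] pos[of x] t \<tau> by (intro mult_nonpos_nonneg) auto
        then show "\<exists>y. (W has_real_derivative y) (at x) \<and> y \<le> 0" using dW by blast
      qed
      also have "\<dots> \<le> k * p 0 / 2" using p0 \<open>\<kappa> \<ge> 0\<close> by (simp add: W_def r0)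
      finally show ?thesis .
    qed
    \<comment> \<open>\<open>p / \<phi>\<close> minus the linear function with the slope that bounds its derivative\<close>
    define z where "z t = p t * exp (- \<kappa> * t) - k * p 0 / 2 * exp (- 2 * \<kappa>) * t" for t
    have dz: "(z has_real_derivative W t * exp (- 2 * \<kappa> * t) - k * p 0 / 2 * exp (- 2 * \<kappa>)) (at t)" for t
    proof -
      have e: "exp (- \<kappa> * t) = exp (\<kappa> * t) * exp (- 2 * \<kappa> * t)" by (simp add: exp_add[symmetric])
      have "(z has_real_derivative (r t / 2 - \<kappa> * p t) * exp (- \<kappa> * t) - k * p 0 / 2 * exp (- 2 * \<kappa>)) (at t)"
        unfolding z_def[abs_def]
        by (rule derivative_eq_intros dp dr refl | simp)+ (simp add: algebra_simps)
      then show ?thesis unfolding W_def e by (simp add: mult.assoc)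
    qed
    have "z \<tau> \<le> z 0"
    proof (rule DERIV_nonpos_imp_nonincreasing[OF less_imp_le[OF \<tau>(1)]])
      fix x assume x: "0 \<le> x" "x \<le> \<tau>"
      have kp: "k * p 0 / 2 \<le> 0" using k p0 by (simp add: mult_nonpos_nonneg)
      have "W x * exp (- 2 * \<kappa> * x) \<le> k * p 0 / 2 * exp (- 2 * \<kappa> * x)"
        using W[OF x] by (intro mult_right_mono) auto
      also have "\<dots> \<le> k * p 0 / 2 * exp (- 2 * \<kappa>)"
        using kp x \<tau> \<open>\<kappa> \<ge> 0\<close> by (intro mult_left_mono_neg) (auto simp: mult_left_le)
      finally show "\<exists>y. (z has_real_derivative y) (at x) \<and> y \<le> 0" using dz by fastforce
    qed
    moreover have "z 0 = p 0" by (simp add: z_def)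
    moreover have "k * p 0 / 2 * exp (- 2 * \<kappa>) * \<tau> = - p 0"
      using k by (simp add: \<tau>_def exp_minus field_simps)
    ultimately have "p \<tau> * exp (- \<kappa> * \<tau>) \<le> 0" by (simp add: z_def)
    then show False using pos[of \<tau>] \<tau> by (simp add: mult_le_0_iff)
  qed
  then obtain s where s: "0 \<le> s" "s \<le> \<tau>" "p s \<le> 0" by auto
  have "continuous_on {0..s} p" using dp by (meson DERIV_isCont continuous_at_imp_continuous_on)
  then obtain t where "0 \<le> t" "t \<le> s" "p t = 0"
    using IVT2'[of p s 0 0] s p0 by auto
  moreover have "t \<noteq> 0" using p0 calculation by auto
  ultimately show ?thesis using that[of t] s by (auto simp: \<tau>_def)
qed

section \<open>Continuity in time in supremum and mean square norms\<close>

lemma AE_le_imp_le_of_continuous: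
  fixes f :: "real \<Rightarrow> real"
  assumes "continuous_on UNIV f" "AE x in lborel. f x \<le> c"
  shows "f x \<le> c"
proof (rule ccontr)
  assume "\<not> f x \<le> c"
  define S where "S = {x. c < f x}"
  have "open S" unfolding S_def by (intro open_Collect_less assms(1) continuous_on_const)
  moreover have "x \<in> S" using \<open>\<not> f x \<le> c\<close> by (simp add: S_def)
  ultimately have "\<not> negligible S" using open_not_negligible by blast
  moreover have "S \<in> null_sets lborel"
    using assms(2) \<open>open S\<close> by (subst AE_iff_null_sets) (auto simp: S_def not_less)
  then have "negligible S"
    by (simp add: negligible_iff_null_sets null_sets_completionI)
  ultimately show False by simp
qed

lemma Linf_norm_le_AE:
  assumes "Linf_norm f \<le> ennreal c" "0 \<le> c"
  shows "AE x in lborel. \<bar>f x\<bar> \<le> c"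
  using esssup_AE[of "\<lambda>x. ennreal \<bar>f x\<bar>" lborel]
proof eventually_elim
  case (elim x)
  then have "ennreal \<bar>f x\<bar> \<le> ennreal c" using assms(1) by (simp add: Linf_norm_def)
  then show ?case using assms(2) by (simp add: ennreal_le_iff)
qed

lemma Linf_AE_bounded:
  assumes "f \<in> Linf"
  obtains B where "0 \<le> B" "AE x in lborel. \<bar>f x\<bar> \<le> B"
proof (rule that[of "enn2real (Linf_norm f)"])
  show "AE x in lborel. \<bar>f x\<bar> \<le> enn2real (Linf_norm f)"
    using assms by (intro Linf_norm_le_AE) (auto simp: Linf_def less_top)
qed simp

lemma Linf_continuous_bounded:
  assumes "f \<in> Linf" "continuous_on UNIV f"
  obtains B where "0 \<le> B" "\<And>x. \<bar>f x\<bar> \<le> B"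
proof -
  obtain B where "0 \<le> B" "AE x in lborel. \<bar>f x\<bar> \<le> B" using Linf_AE_bounded[OF assms(1)] .
  moreover have "continuous_on UNIV (\<lambda>x. \<bar>f x\<bar>)" using assms(2) by (intro continuous_intros)
  ultimately show ?thesis using that AE_le_imp_le_of_continuous by blast
qed

text \<open>The difference quotients are essentially bounded near \<open>t\<close>; continuity in the space variable
  turns the bound almost everywhere into a bound at every label.\<close>

lemma time_deriv_Linf_locally_lipschitz:
  assumes der: "has_time_deriv_Linf f D t" and inf: "\<And>s. f s \<in> Linf"
    and cont: "\<And>s. continuous_on UNIV (f s)"
  shows "\<exists>\<delta>>0. \<exists>C\<ge>0. \<forall>s \<xi>. \<bar>s - t\<bar> < \<delta> \<longrightarrow> \<bar>f s \<xi> - f t \<xi>\<bar> \<le> C * \<bar>s - t\<bar>"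
proof -
  have "\<forall>\<^sub>F s in at t. Linf_norm (\<lambda>\<xi>. (f s \<xi> - f t \<xi>) / (s - t) - D \<xi>) < 1"
    using der unfolding has_time_deriv_Linf_def by (rule order_tendstoD(2)) simp
  then obtain \<delta> where \<delta>: "0 < \<delta>" and
    less1: "\<And>s. s \<noteq> t \<Longrightarrow> \<bar>s - t\<bar> < \<delta> \<Longrightarrow> Linf_norm (\<lambda>\<xi>. (f s \<xi> - f t \<xi>) / (s - t) - D \<xi>) < 1"
    by (auto simp: eventually_at dist_real_def)
  have quot: "AE \<xi> in lborel. \<bar>(f s \<xi> - f t \<xi>) / (s - t) - D \<xi>\<bar> \<le> 1" if "s \<noteq> t" "\<bar>s - t\<bar> < \<delta>" for s
    using less1[OF that] by (intro Linf_norm_le_AE) auto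
  \<comment> \<open>one fixed difference quotient bounds \<open>D\<close>, about which nothing else is known\<close>
  define s0 where "s0 = t + \<delta> / 2"
  have s0: "s0 \<noteq> t" "\<bar>s0 - t\<bar> < \<delta>" using \<delta> by (auto simp: s0_def)
  obtain B1 where B1: "0 \<le> B1" "\<And>\<xi>. \<bar>f s0 \<xi>\<bar> \<le> B1"
    using Linf_continuous_bounded[OF inf cont] by metis
  obtain B2 where B2: "0 \<le> B2" "\<And>\<xi>. \<bar>f t \<xi>\<bar> \<le> B2"
    using Linf_continuous_bounded[OF inf cont] by metis
  define C where "C = 2 + (B1 + B2) / \<bar>s0 - t\<bar>"
  have C: "0 \<le> C" using B1 B2 by (simp add: C_def)
  have D: "AE \<xi> in lborel. \<bar>D \<xi>\<bar> \<le> C - 1"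
    using quot[OF s0]
  proof eventually_elim
    case (elim \<xi>)
    have "\<bar>(f s0 \<xi> - f t \<xi>) / (s0 - t)\<bar> \<le> (B1 + B2) / \<bar>s0 - t\<bar>"
      using B1(2)[of \<xi>] B2(2)[of \<xi>] by (auto simp: abs_divide intro!: divide_right_mono)
    then show ?case using elim unfolding C_def by linarith
  qed
  have "\<bar>f s \<xi> - f t \<xi>\<bar> \<le> C * \<bar>s - t\<bar>" if s: "\<bar>s - t\<bar> < \<delta>" for s \<xi>
  proof (cases "s = t")
    case False
    have "AE \<xi> in lborel. \<bar>f s \<xi> - f t \<xi>\<bar> \<le> C * \<bar>s - t\<bar>"
      using quot[OF False s] D
    proof eventually_elim
      case (elim \<xi>)
      then have "\<bar>(f s \<xi> - f t \<xi>) / (s - t)\<bar> \<le> C" by linarith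
      then show ?case using False by (simp add: abs_divide divide_le_eq)
    qed
    moreover have "continuous_on UNIV (\<lambda>\<xi>. \<bar>f s \<xi> - f t \<xi>\<bar>)" using cont by (intro continuous_intros)
    ultimately show ?thesis using AE_le_imp_le_of_continuous by blast
  qed simp
  then show ?thesis using \<delta> C by blast
qed

lemma L2_borel: "f \<in> L2 \<Longrightarrow> f \<in> borel_measurable borel"
  by (simp add: L2_def)

lemma L2_norm_sq_finite: "f \<in> L2 \<Longrightarrow> L2_norm_sq f < \<infinity>"
  by (simp add: L2_def)

lemma L2_norm_sq_add_le:
  assumes [measurable]: "f \<in> borel_measurable borel" "g \<in> borel_measurable borel"
  shows "L2_norm_sq (\<lambda>x. f x + g x) \<le> 2 * (L2_norm_sq f + L2_norm_sq g)"
proof -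
  have "(f x + g x)\<^sup>2 \<le> 2 * ((f x)\<^sup>2 + (g x)\<^sup>2)" for x
    using zero_le_power2[of "f x - g x"] by (simp add: power2_eq_square algebra_simps)
  then have "ennreal ((f x + g x)\<^sup>2) \<le> 2 * (ennreal ((f x)\<^sup>2) + ennreal ((g x)\<^sup>2))" for x
    by (simp flip: ennreal_plus ennreal_mult' ennreal_numeral add: ennreal_leI)
  then have "L2_norm_sq (\<lambda>x. f x + g x) \<le> (\<integral>\<^sup>+ x. 2 * (ennreal ((f x)\<^sup>2) + ennreal ((g x)\<^sup>2)) \<partial>lborel)"
    unfolding L2_norm_sq_def by (intro nn_integral_mono) auto
  also have "\<dots> = 2 * (L2_norm_sq f + L2_norm_sq g)"
    unfolding L2_norm_sq_def by (subst nn_integral_cmult, simp, subst nn_integral_add) auto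
  finally show ?thesis .
qed

lemma L2_norm_sq_bounded_mult_le:
  assumes [measurable]: "g \<in> borel_measurable borel" and "\<And>x. \<bar>f x\<bar> \<le> B"
  shows "L2_norm_sq (\<lambda>x. f x * g x) \<le> ennreal (B\<^sup>2) * L2_norm_sq g"
proof -
  have "(f x * g x)\<^sup>2 \<le> B\<^sup>2 * (g x)\<^sup>2" for x
    unfolding power_mult_distrib using assms(2)[of x]
    by (intro mult_right_mono) (auto simp: abs_le_square_iff[symmetric])
  then have "L2_norm_sq (\<lambda>x. f x * g x) \<le> (\<integral>\<^sup>+ x. ennreal (B\<^sup>2) * ennreal ((g x)\<^sup>2) \<partial>lborel)"
    unfolding L2_norm_sq_def by (intro nn_integral_mono) (simp flip: ennreal_mult add: ennreal_leI)
  also have "\<dots> = ennreal (B\<^sup>2) * L2_norm_sq g"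
    unfolding L2_norm_sq_def by (subst nn_integral_cmult) auto
  finally show ?thesis .
qed

lemma tendsto_ennreal_times_const_0:
  assumes "(f \<longlongrightarrow> 0) F" "c < (\<infinity>::ennreal)"
  shows "((\<lambda>s. f s * c) \<longlongrightarrow> 0) F"
  using ennreal_tendsto_cmult[of c f 0 F] assms by (simp add: mult.commute)

lemma tendsto_ennreal_sq_diff_0: "((\<lambda>s. ennreal ((s - t)\<^sup>2)) \<longlongrightarrow> 0) (at t)"
proof -
  have "((\<lambda>s. (s - t)\<^sup>2) \<longlongrightarrow> (t - t)\<^sup>2) (at t)" by (intro tendsto_intros)
  from tendsto_ennrealI[OF this] show ?thesis by simp
qed

lemma tendsto_0_le:
  fixes f g :: "'a \<Rightarrow> ennreal"
  assumes "(g \<longlongrightarrow> 0) F" "\<forall>\<^sub>F s in F. f s \<le> g s"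
  shows "(f \<longlongrightarrow> 0) F"
  by (rule tendsto_sandwich[of "\<lambda>_. 0", OF _ assms(2) tendsto_const assms(1)]) simp

text \<open>A quotient that differs from \<open>D\<close> by a finite amount shows \<open>D \<in> L\<^sup>2\<close>, and then
  \<open>f s - f t = (s - t) (D + E s)\<close> with \<open>E s\<close> small. Measurability of \<open>D\<close> enters because the integral
  defining the norm is subadditive only on measurable functions.\<close>

lemma time_deriv_L2_continuous:
  assumes der: "has_time_deriv_L2 f D t" and L2: "\<And>s. f s \<in> L2"
    and [measurable]: "D \<in> borel_measurable borel"
  shows "((\<lambda>s. L2_norm_sq (\<lambda>\<xi>. f s \<xi> - f t \<xi>)) \<longlongrightarrow> 0) (at t)"
proof -
  define E where "E s \<xi> = (f s \<xi> - f t \<xi>) / (s - t) - D \<xi>" for s \<xi>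
  have [measurable]: "f s \<in> borel_measurable borel" for s using L2 by (rule L2_borel)
  have [measurable]: "E s \<in> borel_measurable borel" for s unfolding E_def by measurable
  have "\<forall>\<^sub>F s in at t. L2_norm_sq (E s) < 1"
    using der unfolding has_time_deriv_L2_def E_def by (rule order_tendstoD(2)) simp
  then obtain \<delta> where \<delta>: "0 < \<delta>" and
    less1: "\<And>s. s \<noteq> t \<Longrightarrow> \<bar>s - t\<bar> < \<delta> \<Longrightarrow> L2_norm_sq (E s) < 1"
    by (auto simp: eventually_at dist_real_def)
  define s0 where "s0 = t + \<delta> / 2"
  have s0: "s0 \<noteq> t" "\<bar>s0 - t\<bar> < \<delta>" using \<delta> by (auto simp: s0_def)
  define k where "k = 1 / (s0 - t)"
  have "L2_norm_sq D = L2_norm_sq (\<lambda>\<xi>. k * (f s0 \<xi> + (-1) * f t \<xi>) + (-1) * E s0 \<xi>)"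
    by (simp add: E_def k_def)
  also have "\<dots> \<le> 2 * (L2_norm_sq (\<lambda>\<xi>. k * (f s0 \<xi> + (-1) * f t \<xi>)) + L2_norm_sq (\<lambda>\<xi>. (-1) * E s0 \<xi>))"
    by (rule L2_norm_sq_add_le) auto
  also have "\<dots> \<le> 2 * (ennreal (\<bar>k\<bar>\<^sup>2) * L2_norm_sq (\<lambda>\<xi>. f s0 \<xi> + (-1) * f t \<xi>) + ennreal (1\<^sup>2) * L2_norm_sq (E s0))"
    by (intro mult_left_mono add_mono L2_norm_sq_bounded_mult_le) auto
  also have "\<dots> \<le> 2 * (ennreal (\<bar>k\<bar>\<^sup>2) * (2 * (L2_norm_sq (f s0) + ennreal (1\<^sup>2) * L2_norm_sq (f t)))
      + ennreal (1\<^sup>2) * L2_norm_sq (E s0))"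
    by (intro mult_left_mono add_mono order_refl order_trans[OF L2_norm_sq_add_le] L2_norm_sq_bounded_mult_le) auto
  also have "\<dots> < \<infinity>"
    using L2_norm_sq_finite[OF L2, of s0] L2_norm_sq_finite[OF L2, of t]
      less_trans[OF less1[OF s0] ennreal_one_less_top]
    by (simp add: ennreal_mult_less_top)
  finally have fin: "L2_norm_sq D < \<infinity>" .
  have "((\<lambda>s. ennreal ((s - t)\<^sup>2) * (2 * (1 + L2_norm_sq D))) \<longlongrightarrow> 0) (at t)"
    using fin by (intro tendsto_ennreal_times_const_0 tendsto_ennreal_sq_diff_0)
      (auto simp: ennreal_mult_less_top)
  then show ?thesis
  proof (rule tendsto_0_le)
    show "\<forall>\<^sub>F s in at t. L2_norm_sq (\<lambda>\<xi>. f s \<xi> - f t \<xi>) \<le> ennreal ((s - t)\<^sup>2) * (2 * (1 + L2_norm_sq D))"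
      unfolding eventually_at
    proof (intro exI[of _ \<delta>] conjI ballI impI)
      fix s assume s: "s \<noteq> t \<and> dist s t < \<delta>"
      have "L2_norm_sq (\<lambda>\<xi>. f s \<xi> - f t \<xi>) = L2_norm_sq (\<lambda>\<xi>. (s - t) * (E s \<xi> + D \<xi>))"
        using s by (simp add: E_def)
      also have "\<dots> \<le> ennreal (\<bar>s - t\<bar>\<^sup>2) * L2_norm_sq (\<lambda>\<xi>. E s \<xi> + D \<xi>)"
        by (intro L2_norm_sq_bounded_mult_le) auto
      also have "\<dots> \<le> ennreal (\<bar>s - t\<bar>\<^sup>2) * (2 * (1 + L2_norm_sq D))"
        using less1[of s] s
        by (intro mult_left_mono order_trans[OF L2_norm_sq_add_le] add_mono)
          (auto simp: dist_real_def intro: less_imp_le)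
      finally show "L2_norm_sq (\<lambda>\<xi>. f s \<xi> - f t \<xi>) \<le> ennreal ((s - t)\<^sup>2) * (2 * (1 + L2_norm_sq D))"
        by simp
    qed (rule \<delta>)
  qed
qed

lemma tendsto_0_ennreal_power2D:
  fixes f :: "'a \<Rightarrow> ennreal"
  assumes "((\<lambda>s. (f s)\<^sup>2) \<longlongrightarrow> 0) F"
  shows "(f \<longlongrightarrow> 0) F"
proof (rule order_tendstoI)
  fix e :: ennreal assume "0 < e"
  then have "\<forall>\<^sub>F s in F. (f s)\<^sup>2 < e\<^sup>2" using assms by (intro order_tendstoD(2)) (auto simp: zero_less_iff_neq_zero)
  then show "\<forall>\<^sub>F s in F. f s < e"
  proof eventually_elim
    case (elim s)
    then show ?case using power_mono[of e "f s" 2] by (meson leD leI zero_le)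
  qed
qed simp

lemma L1_norm_mult_le:
  assumes [measurable]: "f \<in> borel_measurable borel" "g \<in> borel_measurable borel"
  shows "(\<integral>\<^sup>+x. ennreal \<bar>f x * g x\<bar> \<partial>lborel)\<^sup>2 \<le> L2_norm_sq f * L2_norm_sq g"
  using Cauchy_Schwarz_nn_integral[of "\<lambda>x. ennreal \<bar>f x\<bar>" lborel "\<lambda>x. ennreal \<bar>g x\<bar>"]
  by (simp add: L2_norm_sq_def abs_mult ennreal_mult ennreal_power)

lemma L2_mult_integrable:
  assumes "f \<in> L2" "g \<in> L2"
  shows "integrable lborel (\<lambda>x. f x * g x)"
proof (rule integrableI_bounded)
  have [measurable]: "f \<in> borel_measurable borel" "g \<in> borel_measurable borel"
    using assms by (auto dest: L2_borel)
  show "(\<lambda>x. f x * g x) \<in> borel_measurable lborel" by measurable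
  have "(\<integral>\<^sup>+x. ennreal \<bar>f x * g x\<bar> \<partial>lborel)\<^sup>2 \<le> L2_norm_sq f * L2_norm_sq g"
    by (rule L1_norm_mult_le) auto
  also have "\<dots> < \<infinity>" using assms by (simp add: L2_def ennreal_mult_less_top)
  finally show "(\<integral>\<^sup>+x. ennreal (norm (f x * g x)) \<partial>lborel) < \<infinity>"
    by (simp add: power_less_top_ennreal)
qed

text \<open>Both factors converge in \<open>L\<^sup>2\<close>; expanding \<open>ab - a\<^sub>0b\<^sub>0 = (a - a\<^sub>0)(b - b\<^sub>0) + (a - a\<^sub>0)b\<^sub>0 + (b - b\<^sub>0)a\<^sub>0\<close>
  and applying the Cauchy--Schwarz inequality to each term gives \<open>L\<^sup>1\<close> convergence of the product.\<close>

lemma L1_tendsto_mult: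
  assumes "\<And>s. a s \<in> L2" "\<And>s. b s \<in> L2"
    and "((\<lambda>s. L2_norm_sq (\<lambda>\<xi>. a s \<xi> - a t \<xi>)) \<longlongrightarrow> 0) (at t)"
    and "((\<lambda>s. L2_norm_sq (\<lambda>\<xi>. b s \<xi> - b t \<xi>)) \<longlongrightarrow> 0) (at t)"
  shows "((\<lambda>s. \<integral>\<^sup>+\<xi>. ennreal \<bar>a s \<xi> * b s \<xi> - a t \<xi> * b t \<xi>\<bar> \<partial>lborel) \<longlongrightarrow> 0) (at t)"
proof -
  have [measurable]: "a s \<in> borel_measurable borel" "b s \<in> borel_measurable borel" for s
    using assms by (auto dest: L2_borel)
  define N where "N f = (\<integral>\<^sup>+\<xi>. ennreal \<bar>f \<xi>\<bar> \<partial>lborel)" for f :: "real \<Rightarrow> real"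
  have lim: "((\<lambda>s. N (\<lambda>\<xi>. f s \<xi> * g s \<xi>)) \<longlongrightarrow> 0) (at t)"
    if [measurable]: "\<And>s. f s \<in> borel_measurable borel" "\<And>s. g s \<in> borel_measurable borel"
      and f0: "((\<lambda>s. L2_norm_sq (f s) * L2_norm_sq (g s)) \<longlongrightarrow> 0) (at t)" for f g
  proof (rule tendsto_0_ennreal_power2D)
    show "((\<lambda>s. (N (\<lambda>\<xi>. f s \<xi> * g s \<xi>))\<^sup>2) \<longlongrightarrow> 0) (at t)"
      unfolding N_def by (rule tendsto_0_le[OF f0]) (intro always_eventually allI L1_norm_mult_le that)
  qed
  have 1: "((\<lambda>s. N (\<lambda>\<xi>. (a s \<xi> - a t \<xi>) * (b s \<xi> - b t \<xi>))) \<longlongrightarrow> 0) (at t)"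
  proof (rule lim)
    show "((\<lambda>s. L2_norm_sq (\<lambda>\<xi>. a s \<xi> - a t \<xi>) * L2_norm_sq (\<lambda>\<xi>. b s \<xi> - b t \<xi>)) \<longlongrightarrow> 0) (at t)"
      using tendsto_mult_ennreal[OF assms(3,4)] by simp
  qed auto
  have 2: "((\<lambda>s. N (\<lambda>\<xi>. (a s \<xi> - a t \<xi>) * b t \<xi>)) \<longlongrightarrow> 0) (at t)"
    using assms by (intro lim tendsto_ennreal_times_const_0 L2_norm_sq_finite) auto
  have 3: "((\<lambda>s. N (\<lambda>\<xi>. (b s \<xi> - b t \<xi>) * a t \<xi>)) \<longlongrightarrow> 0) (at t)"
    using assms by (intro lim tendsto_ennreal_times_const_0 L2_norm_sq_finite) auto
  have "((\<lambda>s. N (\<lambda>\<xi>. (a s \<xi> - a t \<xi>) * (b s \<xi> - b t \<xi>)) + N (\<lambda>\<xi>. (a s \<xi> - a t \<xi>) * b t \<xi>)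
      + N (\<lambda>\<xi>. (b s \<xi> - b t \<xi>) * a t \<xi>)) \<longlongrightarrow> 0 + 0 + 0) (at t)"
    by (intro tendsto_add 1 2 3)
  then show ?thesis unfolding add_0
  proof (rule tendsto_0_le, intro always_eventually allI)
    fix s
    have "\<bar>a s \<xi> * b s \<xi> - a t \<xi> * b t \<xi>\<bar> \<le> \<bar>(a s \<xi> - a t \<xi>) * (b s \<xi> - b t \<xi>)\<bar>
        + \<bar>(a s \<xi> - a t \<xi>) * b t \<xi>\<bar> + \<bar>(b s \<xi> - b t \<xi>) * a t \<xi>\<bar>" for \<xi>
    proof -
      have "a s \<xi> * b s \<xi> - a t \<xi> * b t \<xi> = (a s \<xi> - a t \<xi>) * (b s \<xi> - b t \<xi>)
        + (a s \<xi> - a t \<xi>) * b t \<xi> + (b s \<xi> - b t \<xi>) * a t \<xi>" by (simp add: algebra_simps)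
      then show ?thesis by linarith
    qed
    then have "(\<integral>\<^sup>+\<xi>. ennreal \<bar>a s \<xi> * b s \<xi> - a t \<xi> * b t \<xi>\<bar> \<partial>lborel) \<le>
      (\<integral>\<^sup>+\<xi>. ennreal \<bar>(a s \<xi> - a t \<xi>) * (b s \<xi> - b t \<xi>)\<bar>
        + ennreal \<bar>(a s \<xi> - a t \<xi>) * b t \<xi>\<bar> + ennreal \<bar>(b s \<xi> - b t \<xi>) * a t \<xi>\<bar> \<partial>lborel)"
      by (intro nn_integral_mono) (simp flip: ennreal_plus add: ennreal_leI)
    also have "\<dots> = N (\<lambda>\<xi>. (a s \<xi> - a t \<xi>) * (b s \<xi> - b t \<xi>)) + N (\<lambda>\<xi>. (a s \<xi> - a t \<xi>) * b t \<xi>)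
      + N (\<lambda>\<xi>. (b s \<xi> - b t \<xi>) * a t \<xi>)"
      unfolding N_def by (simp add: nn_integral_add)
    finally show "(\<integral>\<^sup>+\<xi>. ennreal \<bar>a s \<xi> * b s \<xi> - a t \<xi> * b t \<xi>\<bar> \<partial>lborel) \<le> \<dots>" .
  qed
qed

lemma L2_tendsto_bounded_mult:
  assumes a: "\<And>s. a s \<in> borel_measurable borel" and b: "\<And>s. b s \<in> L2" and \<delta>: "0 < \<delta>"
    and lip: "\<And>s \<xi>. \<bar>s - t\<bar> < \<delta> \<Longrightarrow> \<bar>a s \<xi> - a t \<xi>\<bar> \<le> C * \<bar>s - t\<bar>"
    and B: "\<And>\<xi>. \<bar>a t \<xi>\<bar> \<le> B"
    and lim: "((\<lambda>s. L2_norm_sq (\<lambda>\<xi>. b s \<xi> - b t \<xi>)) \<longlongrightarrow> 0) (at t)"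
  shows "((\<lambda>s. L2_norm_sq (\<lambda>\<xi>. a s \<xi> * b s \<xi> - a t \<xi> * b t \<xi>)) \<longlongrightarrow> 0) (at t)"
proof -
  have [measurable]: "a s \<in> borel_measurable borel" "b s \<in> borel_measurable borel" for s
    using a b by (auto dest: L2_borel)
  define M where "M = B + \<bar>C\<bar> * \<delta>"
  have aM: "\<bar>a s \<xi>\<bar> \<le> M" if "\<bar>s - t\<bar> < \<delta>" for s \<xi>
  proof -
    have "C * \<bar>s - t\<bar> \<le> \<bar>C\<bar> * \<delta>" using that by (intro mult_mono) auto
    then show ?thesis using lip[OF that, of \<xi>] B[of \<xi>] unfolding M_def by linarith
  qed
  let ?R = "\<lambda>s. 2 * (L2_norm_sq (\<lambda>\<xi>. b s \<xi> - b t \<xi>) * ennreal (M\<^sup>2) +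
      ennreal ((s - t)\<^sup>2) * (ennreal (C\<^sup>2) * L2_norm_sq (b t)))"
  have fin: "ennreal (C\<^sup>2) * L2_norm_sq (b t) < \<infinity>"
    using L2_norm_sq_finite[OF b] by (simp add: ennreal_mult_less_top)
  have "((\<lambda>s. L2_norm_sq (\<lambda>\<xi>. b s \<xi> - b t \<xi>) * ennreal (M\<^sup>2) +
      ennreal ((s - t)\<^sup>2) * (ennreal (C\<^sup>2) * L2_norm_sq (b t))) \<longlongrightarrow> 0 + 0) (at t)"
    by (intro tendsto_add tendsto_ennreal_times_const_0 lim fin tendsto_ennreal_sq_diff_0) simp
  then have "(?R \<longlongrightarrow> 0) (at t)"
    using ennreal_tendsto_cmult[of 2 _ 0 "at t"] by (simp del: distrib_left_numeral)
  then show ?thesis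
  proof (rule tendsto_0_le)
    show "\<forall>\<^sub>F s in at t. L2_norm_sq (\<lambda>\<xi>. a s \<xi> * b s \<xi> - a t \<xi> * b t \<xi>) \<le> ?R s"
      unfolding eventually_at
    proof (intro exI[of _ \<delta>] conjI ballI impI)
      fix s assume "s \<noteq> t \<and> dist s t < \<delta>"
      then have s: "\<bar>s - t\<bar> < \<delta>" by (simp add: dist_real_def)
      have "L2_norm_sq (\<lambda>\<xi>. a s \<xi> * b s \<xi> - a t \<xi> * b t \<xi>)
        = L2_norm_sq (\<lambda>\<xi>. a s \<xi> * (b s \<xi> - b t \<xi>) + (a s \<xi> - a t \<xi>) * b t \<xi>)"
        by (simp add: algebra_simps)
      also have "\<dots> \<le> 2 * (L2_norm_sq (\<lambda>\<xi>. a s \<xi> * (b s \<xi> - b t \<xi>)) + L2_norm_sq (\<lambda>\<xi>. (a s \<xi> - a t \<xi>) * b t \<xi>))"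
        by (rule L2_norm_sq_add_le) auto
      also have "\<dots> \<le> 2 * (ennreal (M\<^sup>2) * L2_norm_sq (\<lambda>\<xi>. b s \<xi> - b t \<xi>) + ennreal ((C * \<bar>s - t\<bar>)\<^sup>2) * L2_norm_sq (b t))"
        using aM[OF s] lip[OF s] by (intro mult_left_mono add_mono L2_norm_sq_bounded_mult_le) auto
      also have "\<dots> = ?R s"
        by (simp add: power_mult_distrib ennreal_mult ac_simps)
      finally show "L2_norm_sq (\<lambda>\<xi>. a s \<xi> * b s \<xi> - a t \<xi> * b t \<xi>) \<le> ?R s" .
    qed (rule \<delta>)
  qed
qed

section \<open>The potential along a characteristic\<close>

lemma calFD:
  assumes "(z, V, g) \<in> calF"
  shows "continuous_on UNIV z" "continuous_on UNIV V" "z \<in> Linf" "V \<in> Linf" "V \<in> L2" "g \<in> L2"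
    "wderiv z \<in> L2" "wderiv V \<in> L2"
    "AE \<eta> in lborel. 0 \<le> chr_x z \<eta> \<and> 0 \<le> g \<eta>"
    "AE \<eta> in lborel. chr_x z \<eta> * g \<eta> = (wderiv V \<eta>)\<^sup>2"
  using assms by (auto simp: calF_def weakly_differentiable_def)

lemma P_op_nonneg:
  assumes "(z, V, g) \<in> calF"
  shows "0 \<le> P_op z V g \<xi>"
proof -
  have "AE \<eta> in lborel. 0 \<le> exp (- \<bar>chr z \<xi> - chr z \<eta>\<bar>) * (2 * (V \<eta>)\<^sup>2 * chr_x z \<eta> + g \<eta>)"
    using calFD(9)[OF assms] by eventually_elim auto
  then show ?thesis unfolding P_op_def by (intro mult_nonneg_nonneg integral_nonneg_AE) auto
qed

lemma P_op_borel_measurable: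
  assumes "(z, V, g) \<in> calF"
  shows "P_op z V g \<in> borel_measurable borel"
proof -
  have [measurable]: "z \<in> borel_measurable borel" "V \<in> borel_measurable borel"
    "g \<in> borel_measurable borel" "wderiv z \<in> borel_measurable borel"
    using calFD[OF assms] by (auto dest: L2_borel intro: borel_measurable_continuous_onI)
  show ?thesis unfolding P_op_def[abs_def] chr_def chr_x_def by measurable
qed

text \<open>The relation \<open>y\<^sub>\<xi> h = U\<^sub>\<xi>\<^sup>2\<close> turns the density into the sum \<open>G\<close> of products of two factors in
  \<open>L\<^sup>2\<close>, each continuous in time; the cubic term \<open>U\<^sup>2 \<zeta>\<^sub>\<xi>\<close> is split as \<open>U (U \<zeta>\<^sub>\<xi>)\<close>, where the
  boundedness of \<open>U\<close> puts the second factor in \<open>L\<^sup>2\<close>.\<close>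

lemma L1_energy_density:
  assumes z: "\<And>s. (\<zeta> s, U s, h s) \<in> calF"
    and zx: "((\<lambda>s. L2_norm_sq (\<lambda>\<xi>. wderiv (\<zeta> s) \<xi> - wderiv (\<zeta> t) \<xi>)) \<longlongrightarrow> 0) (at t)"
    and Ux: "((\<lambda>s. L2_norm_sq (\<lambda>\<xi>. wderiv (U s) \<xi> - wderiv (U t) \<xi>)) \<longlongrightarrow> 0) (at t)"
    and U: "((\<lambda>s. L2_norm_sq (\<lambda>\<xi>. U s \<xi> - U t \<xi>)) \<longlongrightarrow> 0) (at t)"
    and h: "((\<lambda>s. L2_norm_sq (\<lambda>\<xi>. h s \<xi> - h t \<xi>)) \<longlongrightarrow> 0) (at t)"
    and \<delta>: "0 < \<delta>" and lip: "\<And>s \<xi>. \<bar>s - t\<bar> < \<delta> \<Longrightarrow> \<bar>U s \<xi> - U t \<xi>\<bar> \<le> C * \<bar>s - t\<bar>"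
  defines "g \<equiv> (\<lambda>s \<eta>. 2 * (U s \<eta>)\<^sup>2 * chr_x (\<zeta> s) \<eta> + h s \<eta>)"
  shows "integrable lborel (g s)"
    and "((\<lambda>s. \<integral>\<^sup>+\<eta>. ennreal \<bar>g s \<eta> - g t \<eta>\<bar> \<partial>lborel) \<longlongrightarrow> 0) (at t)"
proof -
  have L2: "U s \<in> L2" "h s \<in> L2" "wderiv (\<zeta> s) \<in> L2" "wderiv (U s) \<in> L2" for s
    using calFD[OF z] by auto
  have m[measurable]: "U s \<in> borel_measurable borel" "h s \<in> borel_measurable borel"
     "wderiv (\<zeta> s) \<in> borel_measurable borel" "wderiv (U s) \<in> borel_measurable borel" for s
    using L2 by (auto intro: L2_borel)
  define w where "w s \<eta> = U s \<eta> * wderiv (\<zeta> s) \<eta>" for s \<eta>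
  have w: "w s \<in> L2" for s
  proof -
    obtain B where B: "\<And>x. \<bar>U s x\<bar> \<le> B" using Linf_continuous_bounded calFD[OF z] by metis
    have "L2_norm_sq (w s) \<le> ennreal (B\<^sup>2) * L2_norm_sq (wderiv (\<zeta> s))"
      unfolding w_def by (rule L2_norm_sq_bounded_mult_le) (auto simp: B)
    also have "\<dots> < \<infinity>" using L2_norm_sq_finite[OF L2(3)] by (simp add: ennreal_mult_less_top)
    finally show ?thesis unfolding w_def[abs_def] by (simp add: L2_def)
  qed
  have wt: "((\<lambda>s. L2_norm_sq (\<lambda>\<xi>. w s \<xi> - w t \<xi>)) \<longlongrightarrow> 0) (at t)"
  proof -
    obtain B where B: "\<And>x. \<bar>U t x\<bar> \<le> B" using Linf_continuous_bounded calFD[OF z] by metis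
    show ?thesis unfolding w_def
      by (rule L2_tendsto_bounded_mult[OF m(1) L2(3) \<delta> lip B zx])
  qed
  define G where "G s \<eta> = 2 * (U s \<eta> * U s \<eta>) + 2 * (U s \<eta> * w s \<eta>)
    + wderiv (U s) \<eta> * wderiv (U s) \<eta> - wderiv (\<zeta> s) \<eta> * h s \<eta>" for s \<eta>
  have gG: "AE \<eta> in lborel. g s \<eta> = G s \<eta>" for s
    using calFD(10)[OF z[of s]]
    by eventually_elim (simp add: g_def G_def w_def chr_x_def power2_eq_square algebra_simps)
  have gm[measurable]: "g s \<in> borel_measurable borel" "G s \<in> borel_measurable borel" for s
    using L2_borel[OF w] unfolding g_def G_def chr_x_def by measurable
  have "integrable lborel (G s)" for s
    unfolding G_def using L2 w
    by (intro Bochner_Integration.integrable_add Bochner_Integration.integrable_diff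
        integrable_mult_right L2_mult_integrable) auto
  then show "integrable lborel (g s)"
    by (subst integrable_cong_AE[OF _ _ gG]) auto
  define N where "N a b s = (\<integral>\<^sup>+\<eta>. ennreal \<bar>a s \<eta> * b s \<eta> - a t \<eta> * b t \<eta>\<bar> \<partial>lborel)"
    for a b :: "real \<Rightarrow> real \<Rightarrow> real" and s
  have "((\<lambda>s. 2 * N U U s + 2 * N U w s + N (\<lambda>s. wderiv (U s)) (\<lambda>s. wderiv (U s)) s
      + N (\<lambda>s. wderiv (\<zeta> s)) h s) \<longlongrightarrow> 2 * 0 + 2 * 0 + 0 + 0) (at t)"
    unfolding N_def
    by (intro tendsto_add ennreal_tendsto_cmult L1_tendsto_mult L2 w wt zx Ux U h) auto
  then have lim: "((\<lambda>s. 2 * N U U s + 2 * N U w s + N (\<lambda>s. wderiv (U s)) (\<lambda>s. wderiv (U s)) s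
      + N (\<lambda>s. wderiv (\<zeta> s)) h s) \<longlongrightarrow> 0) (at t)" by simp
  show "((\<lambda>s. \<integral>\<^sup>+\<eta>. ennreal \<bar>g s \<eta> - g t \<eta>\<bar> \<partial>lborel) \<longlongrightarrow> 0) (at t)"
  proof (rule tendsto_0_le[OF lim], intro always_eventually allI)
    fix s
    have [measurable]: "w s \<in> borel_measurable borel" for s by (rule L2_borel[OF w])
    let ?d = "\<lambda>a b \<eta>. ennreal \<bar>a s \<eta> * b s \<eta> - a t \<eta> * b t \<eta>\<bar>"
    have "(\<integral>\<^sup>+\<eta>. ennreal \<bar>g s \<eta> - g t \<eta>\<bar> \<partial>lborel) \<le>
      (\<integral>\<^sup>+\<eta>. 2 * ?d U U \<eta> + 2 * ?d U w \<eta> + ?d (\<lambda>s. wderiv (U s)) (\<lambda>s. wderiv (U s)) \<eta>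
        + ?d (\<lambda>s. wderiv (\<zeta> s)) h \<eta> \<partial>lborel)"
    proof (rule nn_integral_mono_AE)
      show "AE \<eta> in lborel. ennreal \<bar>g s \<eta> - g t \<eta>\<bar> \<le> 2 * ?d U U \<eta> + 2 * ?d U w \<eta>
        + ?d (\<lambda>s. wderiv (U s)) (\<lambda>s. wderiv (U s)) \<eta> + ?d (\<lambda>s. wderiv (\<zeta> s)) h \<eta>"
        using gG[of s] gG[of t]
      proof eventually_elim
        case (elim \<eta>)
        let ?e = "\<lambda>a b. \<bar>a s \<eta> * b s \<eta> - a t \<eta> * b t \<eta>\<bar>"
        have "\<bar>g s \<eta> - g t \<eta>\<bar> \<le> 2 * ?e U U + 2 * ?e U w + ?e (\<lambda>s. wderiv (U s)) (\<lambda>s. wderiv (U s))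
          + ?e (\<lambda>s. wderiv (\<zeta> s)) h"
        proof -
          have *: "\<bar>2 * x + 2 * y + z - w\<bar> \<le> 2 * \<bar>x\<bar> + 2 * \<bar>y\<bar> + \<bar>z\<bar> + \<bar>w\<bar>" for x y z w :: real
            by linarith
          have eq: "2 * a + 2 * b + c - d - (2 * a' + 2 * b' + c' - d') =
            2 * (a - a') + 2 * (b - b') + (c - c') - (d - d')" for a b c d a' b' c' d' :: real
            by simp
          show ?thesis unfolding elim G_def eq by (rule *)
        qed
        then have "ennreal \<bar>g s \<eta> - g t \<eta>\<bar> \<le> ennreal (2 * ?e U U + 2 * ?e U w
          + ?e (\<lambda>s. wderiv (U s)) (\<lambda>s. wderiv (U s)) + ?e (\<lambda>s. wderiv (\<zeta> s)) h)"
          by (rule ennreal_leI)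
        then show ?case by (simp add: ennreal_mult)
      qed
    qed
    also have "\<dots> = 2 * N U U s + 2 * N U w s + N (\<lambda>s. wderiv (U s)) (\<lambda>s. wderiv (U s)) s
      + N (\<lambda>s. wderiv (\<zeta> s)) h s"
      unfolding N_def by (simp add: nn_integral_add nn_integral_cmult)
    finally show "(\<integral>\<^sup>+\<eta>. ennreal \<bar>g s \<eta> - g t \<eta>\<bar> \<partial>lborel) \<le> \<dots>" .
  qed
qed

lemma abs_exp_neg_diff_le:
  fixes x y :: real
  assumes "0 \<le> x" "0 \<le> y"
  shows "\<bar>exp (- x) - exp (- y)\<bar> \<le> \<bar>x - y\<bar>"
proof -
  have *: "exp (- a) - exp (- b) \<le> b - a" if "0 \<le> a" "a \<le> b" for a b :: real
  proof -
    have "1 - exp (a - b) \<le> b - a" using exp_ge_add_one_self[of "a - b"] by linarith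
    then have "exp (- a) * (1 - exp (a - b)) \<le> 1 * (b - a)"
      using that by (intro mult_mono) auto
    then show ?thesis by (simp add: algebra_simps flip: exp_add)
  qed
  show ?thesis using *[of x y] *[of y x] assms by (cases "x \<le> y") auto
qed

text \<open>The kernel is at most one and depends Lipschitz continuously on \<open>\<zeta>\<close> in the supremum norm, so
  only \<open>L\<^sup>1\<close> convergence of the density and finiteness of its limit are needed.\<close>

lemma P_op_tendsto:
  assumes z: "\<And>s. (\<zeta> s, U s, h s) \<in> calF"
    and int: "\<And>s. integrable lborel (\<lambda>\<eta>. 2 * (U s \<eta>)\<^sup>2 * chr_x (\<zeta> s) \<eta> + h s \<eta>)"
    and lim: "((\<lambda>s. \<integral>\<^sup>+\<eta>. ennreal \<bar>(2 * (U s \<eta>)\<^sup>2 * chr_x (\<zeta> s) \<eta> + h s \<eta>)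
      - (2 * (U t \<eta>)\<^sup>2 * chr_x (\<zeta> t) \<eta> + h t \<eta>)\<bar> \<partial>lborel) \<longlongrightarrow> 0) (at t)"
    and \<delta>: "0 < \<delta>" and lip: "\<And>s \<xi>. \<bar>s - t\<bar> < \<delta> \<Longrightarrow> \<bar>\<zeta> s \<xi> - \<zeta> t \<xi>\<bar> \<le> C * \<bar>s - t\<bar>"
  shows "((\<lambda>s. P_op (\<zeta> s) (U s) (h s) \<xi>) \<longlongrightarrow> P_op (\<zeta> t) (U t) (h t) \<xi>) (at t)"
proof -
  define g where "g s \<eta> = 2 * (U s \<eta>)\<^sup>2 * chr_x (\<zeta> s) \<eta> + h s \<eta>" for s \<eta>
  define e where "e s \<eta> = exp (- \<bar>chr (\<zeta> s) \<xi> - chr (\<zeta> s) \<eta>\<bar>)" for s \<eta>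
  have int': "integrable lborel (g s)" for s using int by (simp add: g_def[abs_def])
  have [measurable]: "g s \<in> borel_measurable borel" for s
    using borel_measurable_integrable[OF int'] by simp
  have [measurable]: "\<zeta> s \<in> borel_measurable borel" for s
    using calFD(1)[OF z] by (rule borel_measurable_continuous_onI)
  have [measurable]: "e s \<in> borel_measurable borel" for s
    unfolding e_def chr_def by measurable
  have e1: "\<bar>e s \<eta>\<bar> \<le> 1" for s \<eta> by (simp add: e_def)
  have inte: "integrable lborel (\<lambda>\<eta>. e s \<eta> * g s \<eta>)" for s
  proof (rule Bochner_Integration.integrable_bound[OF int'])
    show "AE \<eta> in lborel. norm (e s \<eta> * g s \<eta>) \<le> norm (g s \<eta>)"
      using e1 by (auto simp: abs_mult intro!: mult_left_le_one_le)
  qed simp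
  have P: "P_op (\<zeta> s) (U s) (h s) \<xi> = 1/4 * (LINT \<eta>|lborel. e s \<eta> * g s \<eta>)" for s
    by (simp add: P_op_def e_def g_def)
  have "((\<lambda>s. LINT \<eta>|lborel. e s \<eta> * g s \<eta>) \<longlongrightarrow> (LINT \<eta>|lborel. e t \<eta> * g t \<eta>)) (at t)"
  proof -
    define A where "A = (\<integral>\<^sup>+\<eta>. ennreal \<bar>g t \<eta>\<bar> \<partial>lborel)"
    define I where "I s = (\<integral>\<^sup>+\<eta>. ennreal \<bar>g s \<eta> - g t \<eta>\<bar> \<partial>lborel)" for s
    have A: "A < \<infinity>" using int'[of t] by (simp add: A_def integrable_iff_bounded)
    have "((\<lambda>s. 2 * C * \<bar>s - t\<bar>) \<longlongrightarrow> 2 * C * \<bar>t - t\<bar>) (at t)" by (intro tendsto_intros)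
    then have "((\<lambda>s. ennreal (2 * C * \<bar>s - t\<bar>)) \<longlongrightarrow> 0) (at t)"
      using tendsto_ennrealI by fastforce
    then have "((\<lambda>s. I s + ennreal (2 * C * \<bar>s - t\<bar>) * A) \<longlongrightarrow> 0 + 0) (at t)"
      using lim A unfolding I_def g_def by (intro tendsto_add tendsto_ennreal_times_const_0)
    then have lim': "((\<lambda>s. I s + ennreal (2 * C * \<bar>s - t\<bar>) * A) \<longlongrightarrow> 0) (at t)" by simp
    have "((\<lambda>s. ennreal (norm ((LINT \<eta>|lborel. e s \<eta> * g s \<eta>) - (LINT \<eta>|lborel. e t \<eta> * g t \<eta>)))) \<longlongrightarrow> 0) (at t)"
    proof (rule tendsto_0_le[OF lim'])
      show "\<forall>\<^sub>F s in at t. ennreal (norm ((LINT \<eta>|lborel. e s \<eta> * g s \<eta>) - (LINT \<eta>|lborel. e t \<eta> * g t \<eta>)))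
        \<le> I s + ennreal (2 * C * \<bar>s - t\<bar>) * A"
        unfolding eventually_at
      proof (intro exI[of _ \<delta>] conjI ballI impI)
        fix s assume "s \<noteq> t \<and> dist s t < \<delta>"
        then have s: "\<bar>s - t\<bar> < \<delta>" by (simp add: dist_real_def)
        have C0: "0 \<le> C * \<bar>s - t\<bar>" using lip[OF s, of 0] by linarith
        have ediff: "\<bar>e s \<eta> - e t \<eta>\<bar> \<le> 2 * C * \<bar>s - t\<bar>" for \<eta>
        proof -
          have "\<bar>e s \<eta> - e t \<eta>\<bar> \<le> \<bar>\<bar>chr (\<zeta> s) \<xi> - chr (\<zeta> s) \<eta>\<bar> - \<bar>chr (\<zeta> t) \<xi> - chr (\<zeta> t) \<eta>\<bar>\<bar>"
            unfolding e_def by (rule abs_exp_neg_diff_le) auto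
          also have "\<dots> \<le> \<bar>\<zeta> s \<xi> - \<zeta> t \<xi>\<bar> + \<bar>\<zeta> s \<eta> - \<zeta> t \<eta>\<bar>"
            unfolding chr_def by linarith
          also have "\<dots> \<le> 2 * C * \<bar>s - t\<bar>" using lip[OF s, of \<xi>] lip[OF s, of \<eta>] by linarith
          finally show ?thesis .
        qed
        have "ennreal (norm ((LINT \<eta>|lborel. e s \<eta> * g s \<eta>) - (LINT \<eta>|lborel. e t \<eta> * g t \<eta>)))
          = ennreal (norm (LINT \<eta>|lborel. e s \<eta> * g s \<eta> - e t \<eta> * g t \<eta>))"
          by (simp add: Bochner_Integration.integral_diff[OF inte inte])
        also have "\<dots> \<le> (\<integral>\<^sup>+\<eta>. ennreal (norm (e s \<eta> * g s \<eta> - e t \<eta> * g t \<eta>)) \<partial>lborel)"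
          by (intro integral_norm_bound_ennreal Bochner_Integration.integrable_diff inte)
        also have "\<dots> \<le> (\<integral>\<^sup>+\<eta>. ennreal \<bar>g s \<eta> - g t \<eta>\<bar> + ennreal (2 * C * \<bar>s - t\<bar>) * ennreal \<bar>g t \<eta>\<bar> \<partial>lborel)"
        proof (rule nn_integral_mono)
          fix \<eta>
          have "e s \<eta> * g s \<eta> - e t \<eta> * g t \<eta> = e s \<eta> * (g s \<eta> - g t \<eta>) + (e s \<eta> - e t \<eta>) * g t \<eta>"
            by (simp add: algebra_simps)
          then have "\<bar>e s \<eta> * g s \<eta> - e t \<eta> * g t \<eta>\<bar> \<le> \<bar>e s \<eta>\<bar> * \<bar>g s \<eta> - g t \<eta>\<bar> + \<bar>e s \<eta> - e t \<eta>\<bar> * \<bar>g t \<eta>\<bar>"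
            by (metis abs_mult abs_triangle_ineq)
          also have "\<dots> \<le> 1 * \<bar>g s \<eta> - g t \<eta>\<bar> + (2 * C * \<bar>s - t\<bar>) * \<bar>g t \<eta>\<bar>"
            by (intro add_mono mult_right_mono e1 ediff) auto
          finally have "ennreal \<bar>e s \<eta> * g s \<eta> - e t \<eta> * g t \<eta>\<bar> \<le> ennreal (\<bar>g s \<eta> - g t \<eta>\<bar> + (2 * C * \<bar>s - t\<bar>) * \<bar>g t \<eta>\<bar>)"
            by (simp add: ennreal_leI)
          also have "\<dots> = ennreal \<bar>g s \<eta> - g t \<eta>\<bar> + ennreal (2 * C * \<bar>s - t\<bar>) * ennreal \<bar>g t \<eta>\<bar>"
          proof -
            have *: "ennreal (x + c * y) = ennreal x + ennreal c * ennreal y"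
              if "0 \<le> x" "0 \<le> c" "0 \<le> y" for x c y
              using that by (simp add: ennreal_mult)
            show ?thesis using C0 by (intro *) auto
          qed
          finally show "ennreal (norm (e s \<eta> * g s \<eta> - e t \<eta> * g t \<eta>)) \<le> \<dots>" by simp
        qed
        also have "\<dots> = I s + ennreal (2 * C * \<bar>s - t\<bar>) * A"
          unfolding I_def A_def by (subst nn_integral_add) (auto simp: nn_integral_cmult)
        finally show "ennreal (norm ((LINT \<eta>|lborel. e s \<eta> * g s \<eta>) - (LINT \<eta>|lborel. e t \<eta> * g t \<eta>)))
          \<le> I s + ennreal (2 * C * \<bar>s - t\<bar>) * A" .
      qed (rule \<delta>)
    qed
    then have "((\<lambda>s. norm ((LINT \<eta>|lborel. e s \<eta> * g s \<eta>) - (LINT \<eta>|lborel. e t \<eta> * g t \<eta>))) \<longlongrightarrow> 0) (at t)"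
      using tendsto_ennrealD[of _ 0 "at t"] by simp
    then show ?thesis by (rule LIM_zero_cancel[OF tendsto_norm_zero_cancel])
  qed
  then show ?thesis unfolding P by (intro tendsto_intros)
qed

lemma lagrangian_solutionD:
  assumes "lagrangian_solution u0 \<mu>0 \<zeta> U h"
  shows "(\<zeta> t, U t, h t) \<in> calF"
    and "has_time_deriv_Linf \<zeta> (U t) t"
    and "has_time_deriv (\<lambda>s. wderiv (\<zeta> s)) (wderiv (U t)) t"
    and "has_time_deriv U (\<lambda>\<xi>. - Q_op (\<zeta> t) (U t) (h t) \<xi>) t"
    and "has_time_deriv (\<lambda>s. wderiv (U s))
      (\<lambda>\<xi>. 1/2 * h t \<xi> + ((U t \<xi>)\<^sup>2 - P_op (\<zeta> t) (U t) (h t) \<xi>) * chr_x (\<zeta> t) \<xi>) t"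
    and "has_time_deriv h (\<lambda>\<xi>. 2 * ((U t \<xi>)\<^sup>2 - P_op (\<zeta> t) (U t) (h t) \<xi>) * wderiv (U t) \<xi>) t"
  using assms unfolding lagrangian_solution_def Let_def by auto

lemma Q_op_borel_measurable:
  assumes "(z, V, g) \<in> calF"
  shows "Q_op z V g \<in> borel_measurable borel"
proof -
  have [measurable]: "z \<in> borel_measurable borel" "V \<in> borel_measurable borel"
    "g \<in> borel_measurable borel" "wderiv z \<in> borel_measurable borel"
    using calFD[OF assms] by (auto dest: L2_borel intro: borel_measurable_continuous_onI)
  show ?thesis unfolding Q_op_def[abs_def] chr_def chr_x_def by measurable
qed

lemma velocity_locally_lipschitz:
  assumes sol: "lagrangian_solution u0 \<mu>0 \<zeta> U h"
  shows "\<exists>\<delta>>0. \<exists>C\<ge>0. \<forall>s \<xi>. \<bar>s - t\<bar> < \<delta> \<longrightarrow> \<bar>U s \<xi> - U t \<xi>\<bar> \<le> C * \<bar>s - t\<bar>"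
proof -
  note F = lagrangian_solutionD(1)[OF sol]
  have "has_time_deriv_Linf U (\<lambda>\<xi>. - Q_op (\<zeta> t) (U t) (h t) \<xi>) t"
    using lagrangian_solutionD(4)[OF sol] by (simp add: has_time_deriv_def)
  then show ?thesis
    by (rule time_deriv_Linf_locally_lipschitz[OF _ calFD(4)[OF F] calFD(2)[OF F]])
qed

text \<open>Both \<open>U\<^sup>2\<close> and \<open>P\<close> are evaluated at one fixed label, so continuity in norm is used through
  its pointwise consequences: the Lipschitz bounds hold at every label, not only almost everywhere,
  and \<open>P\<close> at that label is an integral against the \<open>L\<^sup>1\<close> density.\<close>

lemma potential_continuous_in_time:
  assumes sol: "lagrangian_solution u0 \<mu>0 \<zeta> U h"
  shows "continuous_on UNIV (\<lambda>s. (U s \<xi>)\<^sup>2 - P_op (\<zeta> s) (U s) (h s) \<xi>)"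
proof -
  note F = lagrangian_solutionD(1)[OF sol]
  note D = lagrangian_solutionD[OF sol, unfolded has_time_deriv_def]
  have [measurable]: "U s \<in> borel_measurable borel" "h s \<in> borel_measurable borel"
    "wderiv (\<zeta> s) \<in> borel_measurable borel" "wderiv (U s) \<in> borel_measurable borel"
    "P_op (\<zeta> s) (U s) (h s) \<in> borel_measurable borel"
    "Q_op (\<zeta> s) (U s) (h s) \<in> borel_measurable borel" for s
    using calFD[OF F] P_op_borel_measurable[OF F] Q_op_borel_measurable[OF F]
    by (auto intro: L2_borel)
  have "((\<lambda>s. (U s \<xi>)\<^sup>2 - P_op (\<zeta> s) (U s) (h s) \<xi>) \<longlongrightarrow> (U t \<xi>)\<^sup>2 - P_op (\<zeta> t) (U t) (h t) \<xi>) (at t)" for t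
  proof -
    obtain \<delta>1 C1 where lip1: "0 < \<delta>1" "\<And>s \<xi>. \<bar>s - t\<bar> < \<delta>1 \<Longrightarrow> \<bar>U s \<xi> - U t \<xi>\<bar> \<le> C1 * \<bar>s - t\<bar>"
      using velocity_locally_lipschitz[OF sol] by metis
    obtain \<delta>2 C2 where lip2: "0 < \<delta>2" "\<And>s \<xi>. \<bar>s - t\<bar> < \<delta>2 \<Longrightarrow> \<bar>\<zeta> s \<xi> - \<zeta> t \<xi>\<bar> \<le> C2 * \<bar>s - t\<bar>"
      using time_deriv_Linf_locally_lipschitz[OF D(2) calFD(3)[OF F] calFD(1)[OF F]] by metis
    have "((\<lambda>s. \<bar>U s \<xi> - U t \<xi>\<bar>) \<longlongrightarrow> 0) (at t)"
    proof (rule tendsto_sandwich[of "\<lambda>_. 0" _ _ "\<lambda>s. C1 * \<bar>s - t\<bar>"])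
      show "\<forall>\<^sub>F s in at t. \<bar>U s \<xi> - U t \<xi>\<bar> \<le> C1 * \<bar>s - t\<bar>"
        using lip1 by (auto simp: eventually_at dist_real_def)
      have "((\<lambda>s. C1 * \<bar>s - t\<bar>) \<longlongrightarrow> C1 * \<bar>t - t\<bar>) (at t)" by (intro tendsto_intros)
      then show "((\<lambda>s. C1 * \<bar>s - t\<bar>) \<longlongrightarrow> 0) (at t)" by simp
    qed auto
    then have U: "((\<lambda>s. U s \<xi>) \<longlongrightarrow> U t \<xi>) (at t)"
      by (simp add: tendsto_rabs_zero_iff LIM_zero_iff)
    have lims: "((\<lambda>s. L2_norm_sq (\<lambda>\<xi>. wderiv (\<zeta> s) \<xi> - wderiv (\<zeta> t) \<xi>)) \<longlongrightarrow> 0) (at t)"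
       "((\<lambda>s. L2_norm_sq (\<lambda>\<xi>. wderiv (U s) \<xi> - wderiv (U t) \<xi>)) \<longlongrightarrow> 0) (at t)"
       "((\<lambda>s. L2_norm_sq (\<lambda>\<xi>. U s \<xi> - U t \<xi>)) \<longlongrightarrow> 0) (at t)"
       "((\<lambda>s. L2_norm_sq (\<lambda>\<xi>. h s \<xi> - h t \<xi>)) \<longlongrightarrow> 0) (at t)"
      by (rule time_deriv_L2_continuous[OF D(3)[THEN conjunct2]]
          time_deriv_L2_continuous[OF D(5)[THEN conjunct2]]
          time_deriv_L2_continuous[OF D(4)[THEN conjunct2]]
          time_deriv_L2_continuous[OF D(6)[THEN conjunct2]];
        use calFD[OF F] in \<open>simp add: chr_x_def\<close>)+
    note L1 = L1_energy_density[OF F lims lip1]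
    have "((\<lambda>s. P_op (\<zeta> s) (U s) (h s) \<xi>) \<longlongrightarrow> P_op (\<zeta> t) (U t) (h t) \<xi>) (at t)"
      by (rule P_op_tendsto[OF F L1 lip2])
    with U show ?thesis by (intro tendsto_intros)
  qed
  then show ?thesis by (simp add: continuous_on_def)
qed

text \<open>The bound is uniform in the label, which is essential: the label has to be chosen after
  the time scale, on a piece that is steep enough to break within it.\<close>

lemma potential_locally_bounded_above:
  assumes sol: "lagrangian_solution u0 \<mu>0 \<zeta> U h"
  shows "\<exists>\<delta>>0. \<exists>B\<ge>0. \<forall>s \<xi>. \<bar>s - t\<bar> < \<delta> \<longrightarrow>
    (U s \<xi>)\<^sup>2 - P_op (\<zeta> s) (U s) (h s) \<xi> \<le> B\<^sup>2"
proof -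
  note F = lagrangian_solutionD(1)[OF sol]
  obtain \<delta> C where lip: "0 < \<delta>" "0 \<le> C"
    "\<And>s \<xi>. \<bar>s - t\<bar> < \<delta> \<Longrightarrow> \<bar>U s \<xi> - U t \<xi>\<bar> \<le> C * \<bar>s - t\<bar>"
    using velocity_locally_lipschitz[OF sol] by metis
  obtain B where B: "0 \<le> B" "\<And>\<xi>. \<bar>U t \<xi>\<bar> \<le> B"
    using Linf_continuous_bounded[OF calFD(4)[OF F] calFD(2)[OF F]] by metis
  have "(U s \<xi>)\<^sup>2 - P_op (\<zeta> s) (U s) (h s) \<xi> \<le> (B + C * \<delta>)\<^sup>2" if "\<bar>s - t\<bar> < \<delta>" for s \<xi>
  proof -
    have "C * \<bar>s - t\<bar> \<le> C * \<delta>" using that lip(2) by (intro mult_left_mono) auto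
    then have "\<bar>U s \<xi>\<bar> \<le> B + C * \<delta>" using lip(3)[OF that, of \<xi>] B(2)[of \<xi>] by linarith
    then have "(U s \<xi>)\<^sup>2 \<le> (B + C * \<delta>)\<^sup>2" by (metis abs_ge_zero power2_abs power_mono)
    then show ?thesis using P_op_nonneg[OF F, of s \<xi>] by simp
  qed
  moreover have "0 \<le> B + C * \<delta>" using B lip by simp
  ultimately show ?thesis using lip(1) by blast
qed

section \<open>Initial data over an affine piece of the profile\<close>

lemma borel_measurable_piecewise_constant:
  fixes f :: "real \<Rightarrow> real"
  assumes "countable C" "\<Union>C = UNIV" "\<And>S. S \<in> C \<Longrightarrow> S \<in> sets borel"
    and const: "\<And>S. S \<in> C \<Longrightarrow> \<exists>c. \<forall>x\<in>S. f x = c"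
  shows "f \<in> borel_measurable borel"
proof (rule measurable_piecewise_restrict[OF assms(1)])
  show "f \<in> borel_measurable (restrict_space borel S)" if "S \<in> C" for S
  proof -
    obtain c where c: "\<And>x. x \<in> S \<Longrightarrow> f x = c" using const[OF \<open>S \<in> C\<close>] by blast
    have "f \<in> borel_measurable (restrict_space borel S) \<longleftrightarrow> (\<lambda>_. c) \<in> borel_measurable (restrict_space borel S)"
      by (rule measurable_cong) (simp add: space_restrict_space c)
    then show ?thesis by simp
  qed
qed (use assms in auto)

lemma has_real_derivative_affine_on_open:
  fixes f :: "real \<Rightarrow> real"
  assumes "open S" "x \<in> S" "\<And>y. y \<in> S \<Longrightarrow> f y = k * y + d"
  shows "(f has_real_derivative k) (at x)"
proof -
  have "((\<lambda>y. k * y + d) has_real_derivative k) (at x)" by (auto intro!: derivative_eq_intros)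
  then show ?thesis
    by (rule has_field_derivative_transform_within_open[OF _ assms(1,2)]) (simp add: assms(3))
qed

lemma deriv_affine_on_open:
  fixes f :: "real \<Rightarrow> real"
  assumes "open S" "x \<in> S" "\<And>y. y \<in> S \<Longrightarrow> f y = k * y + d"
  shows "deriv f x = k"
  using has_real_derivative_affine_on_open[OF assms] by (rule DERIV_imp_deriv)

context
  fixes q :: real
  assumes q: "0 < q" "q < 1"
begin

lemma one_minus_q_power_4_pos: "0 < 1 - q ^ 4"
  using q power_less_one_iff[of q 4] by simp

lemma node_less_end: "node q n < 2 / (1 - q ^ 4)"
proof -
  have "node q n \<le> node q (2 * n)"
    using strict_mono_less_eq[OF strict_mono_node[OF q(1)]] by simp
  also have "\<dots> < 2 / (1 - q ^ 4)"
    unfolding node_even_odd(1)[OF q] using q one_minus_q_power_4_pos by (intro divide_strict_right_mono) auto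
  finally show ?thesis .
qed

lemma node_pieces_cover:
  assumes "0 \<le> x" "x < 2 / (1 - q ^ 4)"
  obtains j where "x \<in> {node q j..<node q (Suc j)}"
proof -
  have "(\<lambda>j. (q ^ 4) ^ j) \<longlonglongrightarrow> 0"
    using q power_less_one_iff[of q 4] by (intro LIMSEQ_power_zero) auto
  then have "(\<lambda>j. 2 * (1 - (q ^ 4) ^ j) / (1 - q ^ 4)) \<longlonglongrightarrow> 2 * (1 - 0) / (1 - q ^ 4)"
    using one_minus_q_power_4_pos by (intro tendsto_intros) auto
  then have "(\<lambda>j. node q (2 * j)) \<longlonglongrightarrow> 2 / (1 - q ^ 4)"
    unfolding node_even_odd(1)[OF q] by (simp add: power_mult)
  from order_tendstoD(1)[OF this assms(2)] obtain n where n: "x < node q (2 * n)"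
    by (auto simp: eventually_sequentially)
  define m where "m = (LEAST m. x < node q m)"
  have m: "x < node q m" unfolding m_def by (rule LeastI[of _ "2 * n"]) (rule n)
  moreover have "m \<noteq> 0" using m assms(1) by (cases m) auto
  then obtain j where j: "m = Suc j" by (cases m) auto
  moreover have "\<not> x < node q j" using j not_less_Least[of j "\<lambda>m. x < node q m"] by (simp add: m_def)
  ultimately show ?thesis using that[of j] by auto
qed

lemma deriv_profile_on_piece:
  assumes "x \<in> {node q j<..<node q (Suc j)}"
  shows "deriv (profile q) x = slope q j"
  using assms profile_piece[OF q, of _ j]
  by (intro deriv_affine_on_open[where d = "intercept q j", OF open_greaterThanLessThan]) auto

text \<open>The real line is cut into countably many open intervals, on which the profile is affine,
  and the countably many points between them, where it may fail to be differentiable.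
  Measurability is what gives the density in the energy measure its meaning.\<close>

lemma deriv_profile_borel: "deriv (profile q) \<in> borel_measurable borel"
proof -
  define L where "L = 2 / (1 - q ^ 4)"
  have L: "0 < L" using one_minus_q_power_4_pos by (simp add: L_def)
  define C where "C = {{..<- L}, {- L<..<0}, {L<..}, {L}, {- L}} \<union>
    range (\<lambda>j. {node q j<..<node q (Suc j)}) \<union> range (\<lambda>j. {node q j})"
  have outside: "profile q x = 0" if "x < - L \<or> L < x" for x
  proof -
    have "node q 0 \<le> node q j" "node q (Suc j) < L" for j
      using strict_mono_less_eq[OF strict_mono_node[OF q(1)]] node_less_end by (simp_all add: L_def del: node.simps)
    then have "x \<notin> {node q j..node q (Suc j)}" for j
      using that L order.trans[of 0 "node q j" x] order.strict_trans1[of x "node q (Suc j)" L] by fastforce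
    then have "(\<exists>j. x \<in> {node q j..node q (Suc j)}) = False" by blast
    moreover have "(x \<in> {- 2 / (1 - q ^ 4)..0}) = False" using that L by (auto simp: L_def)
    ultimately show ?thesis by (simp only: profile_def if_False)
  qed
  have ramp: "profile q x = q * (1 - q ^ 4) / 4 * x + q / 2" if "x \<in> {- L<..<0}" for x
  proof -
    have "(x \<in> {- 2 / (1 - q ^ 4)..0}) = True" using that by (simp add: L_def)
    then have "profile q x = 1/2 * q * (1 + (1 - q ^ 4) / 2 * x)" by (simp only: profile_def if_True)
    then show ?thesis by (simp add: field_simps)
  qed
  show ?thesis
  proof (rule borel_measurable_piecewise_constant)
    show "countable C" by (simp add: C_def)
    show "\<Union>C = UNIV"
    proof (intro set_eqI iffI UNIV_I)
      fix x :: real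
      show "x \<in> \<Union>C"
      proof (cases "0 \<le> x \<and> x < L")
        case True
        then obtain j where "x \<in> {node q j..<node q (Suc j)}"
          using node_pieces_cover by (auto simp: L_def)
        then have "x \<in> {node q j} \<or> x \<in> {node q j<..<node q (Suc j)}" by auto
        then show ?thesis by (auto simp: C_def)
      next
        case False
        then have "x < - L \<or> x = - L \<or> - L < x \<and> x < 0 \<or> x = L \<or> L < x" by linarith
        then show ?thesis by (auto simp: C_def)
      qed
    qed
    show "S \<in> sets borel" if "S \<in> C" for S using that by (auto simp: C_def)
    show "\<exists>c. \<forall>x\<in>S. deriv (profile q) x = c" if "S \<in> C" for S
    proof -
      have "deriv (profile q) x = 0" if "x \<in> {..<- L}" for x
        using that outside by (intro deriv_affine_on_open[of "{..<- L}" x _ 0 0]) auto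
      moreover have "deriv (profile q) x = 0" if "x \<in> {L<..}" for x
        using that outside by (intro deriv_affine_on_open[of "{L<..}" x _ 0 0]) auto
      moreover have "deriv (profile q) x = q * (1 - q ^ 4) / 4" if "x \<in> {- L<..<0}" for x
        using that ramp by (intro deriv_affine_on_open[of "{- L<..<0}" x _ "q * (1 - q ^ 4) / 4" "q / 2"]) auto
      moreover consider "S = {..<- L}" | "S = {L<..}" | "S = {- L<..<0}" | x where "S = {x}"
        | j where "S = {node q j<..<node q (Suc j)}"
        using \<open>S \<in> C\<close> unfolding C_def by (elim UnE insertE rangeE emptyE) metis+
      ultimately show ?thesis
        using deriv_profile_on_piece by cases (metis singletonD)+
    qed
  qed
qed

end

lemma measure_energy_measure_affine:
  assumes [measurable]: "deriv u \<in> borel_measurable borel" and fin: "finite_measure (energy_measure u)"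
    and slope: "\<And>x. x \<in> {a<..<b} \<Longrightarrow> deriv u x = k" and y: "a \<le> y" "y \<le> b"
  shows "measure (energy_measure u) {..<y} = measure (energy_measure u) {..<a} + k\<^sup>2 * (y - a)"
proof -
  interpret finite_measure "energy_measure u" by (rule fin)
  have [simp]: "sets (energy_measure u) = sets borel" by (simp add: energy_measure_def)
  have "emeasure (energy_measure u) {a..<y} = (\<integral>\<^sup>+ x. ennreal ((deriv u x)\<^sup>2) * indicator {a..<y} x \<partial>lborel)"
    unfolding energy_measure_def by (rule emeasure_density) auto
  also have "\<dots> = (\<integral>\<^sup>+ x. ennreal (k\<^sup>2) * indicator {a..<y} x \<partial>lborel)"
    using AE_lborel_singleton[of a] y slope
    by (intro nn_integral_cong_AE) (auto elim!: eventually_mono simp: indicator_def)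
  also have "\<dots> = ennreal (k\<^sup>2 * (y - a))"
    using y by (simp add: nn_integral_cmult ennreal_mult)
  finally have "measure (energy_measure u) {a..<y} = k\<^sup>2 * (y - a)"
    using y by (simp add: measure_def)
  moreover have "{..<y} = {..<a} \<union> {a..<y}" using y by auto
  then have "measure (energy_measure u) {..<y} = measure (energy_measure u) {..<a} + measure (energy_measure u) {a..<y}"
    by (simp add: finite_measure_Union ivl_disj_int)
  ultimately show ?thesis by simp
qed

text \<open>The function \<open>x \<mapsto> \<mu>\<^sub>0((-\<infinity>, x)) + x\<close> is strictly increasing, because the measure only adds a
  nondecreasing term.\<close>

lemma init_y_inverts_energy_plus_position:
  assumes sets: "sets \<mu>0 = sets borel" and fin: "finite_measure \<mu>0"
  shows "init_y \<mu>0 (measure \<mu>0 {..<x} + x) = x"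
proof -
  interpret finite_measure \<mu>0 by (rule fin)
  have mono: "measure \<mu>0 {..<y} \<le> measure \<mu>0 {..<z}" if "y \<le> z" for y z
    using that by (intro finite_measure_mono) (auto simp: sets)
  have "measure \<mu>0 {..<y} + y < measure \<mu>0 {..<x} + x \<longleftrightarrow> y < x" for y
    using mono[of y x] mono[of x y] by (cases "y < x") auto
  then have "{y. measure \<mu>0 {..<y} + y < measure \<mu>0 {..<x} + x} = {..<x}" by auto
  then show ?thesis by (simp add: init_y_def)
qed

text \<open>Over an affine piece of slope \<open>k\<close> the energy grows at rate \<open>k\<^sup>2\<close>, so \<open>\<mu>\<^sub>0((-\<infinity>, x)) + x\<close> is affine
  there with slope \<open>1 + k\<^sup>2\<close>, and its inverse \<open>y\<^sub>0\<close> is affine with slope \<open>1 / (1 + k\<^sup>2)\<close>.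
  The label found is that of the midpoint of the piece.\<close>

lemma init_data_on_affine_piece:
  assumes meas: "deriv u \<in> borel_measurable borel" and fin: "finite_measure (energy_measure u)"
    and affine: "\<And>x. x \<in> {a..b} \<Longrightarrow> u x = k * x + d" and "a < b"
  obtains \<xi> where
    "(init_y (energy_measure u) has_real_derivative 1 / (1 + k\<^sup>2)) (at \<xi>)"
    "(init_U u (energy_measure u) has_real_derivative k / (1 + k\<^sup>2)) (at \<xi>)"
proof -
  define m where "m = measure (energy_measure u) {..<a}"
  define Y where "Y \<xi> = a + (\<xi> - m - a) / (1 + k\<^sup>2)" for \<xi>
  define S where "S = {m + a<..<m + a + (1 + k\<^sup>2) * (b - a)}"
  have k1: "0 < 1 + k\<^sup>2" by (rule add_pos_nonneg) auto
  have slope: "deriv u x = k" if "x \<in> {a<..<b}" for x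
    using that affine by (intro deriv_affine_on_open[of "{a<..<b}" x]) auto
  have Y_piece: "Y \<xi> \<in> {a..b}" if "\<xi> \<in> S" for \<xi>
  proof -
    have "0 \<le> (\<xi> - m - a) / (1 + k\<^sup>2)" using that k1 by (simp add: S_def)
    moreover have "(\<xi> - m - a) / (1 + k\<^sup>2) \<le> b - a"
      using that k1 by (simp add: S_def pos_divide_le_eq mult.commute)
    ultimately show ?thesis by (simp add: Y_def)
  qed
  have y: "init_y (energy_measure u) \<xi> = Y \<xi>" if "\<xi> \<in> S" for \<xi>
  proof -
    have "measure (energy_measure u) {..<Y \<xi>} = m + k\<^sup>2 * (Y \<xi> - a)"
      using Y_piece[OF that] unfolding m_def
      by (intro measure_energy_measure_affine[OF meas fin slope]) auto
    then have "measure (energy_measure u) {..<Y \<xi>} + Y \<xi> = m + a + (1 + k\<^sup>2) * (Y \<xi> - a)"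
      by (simp add: algebra_simps)
    also have "\<dots> = \<xi>" using k1 by (simp add: Y_def)
    finally show ?thesis
      using init_y_inverts_energy_plus_position[OF _ fin, of "Y \<xi>"] by (simp add: energy_measure_def)
  qed
  have "open S" by (simp add: S_def)
  define \<xi> where "\<xi> = m + a + (1 + k\<^sup>2) * (b - a) / 2"
  have \<xi>: "\<xi> \<in> S" using k1 \<open>a < b\<close> by (simp add: \<xi>_def S_def)
  show ?thesis
  proof (rule that[of \<xi>])
    show "(init_y (energy_measure u) has_real_derivative 1 / (1 + k\<^sup>2)) (at \<xi>)"
      by (rule has_real_derivative_affine_on_open[OF \<open>open S\<close> \<xi>, where d = "a - (m + a) / (1 + k\<^sup>2)"])
        (simp add: y Y_def diff_divide_distrib add_divide_distrib)
    show "(init_U u (energy_measure u) has_real_derivative k / (1 + k\<^sup>2)) (at \<xi>)"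
    proof (rule has_real_derivative_affine_on_open[OF \<open>open S\<close> \<xi>, where d = "k * (a - (m + a) / (1 + k\<^sup>2)) + d"])
      fix \<eta> assume \<eta>: "\<eta> \<in> S"
      have "init_U u (energy_measure u) \<eta> = k * Y \<eta> + d"
        using affine[OF Y_piece[OF \<eta>]] y[OF \<eta>] by (simp add: init_U_def)
      then show "init_U u (energy_measure u) \<eta> = k / (1 + k\<^sup>2) * \<eta> + (k * (a - (m + a) / (1 + k\<^sup>2)) + d)"
        by (simp add: Y_def diff_divide_distrib add_divide_distrib algebra_simps)
    qed
  qed
qed

section \<open>Breaking times near zero\<close>

text \<open>The triple \<open>(p\<^sup>2, p r, r\<^sup>2)\<close> built from a solution of \<open>p' = r / 2\<close>, \<open>r' = K p\<close> solves the pointwise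
  system. The normalisation \<open>p(0)\<^sup>2 = 1 / (1 + k\<^sup>2)\<close>, \<open>r(0) = k p(0)\<close> reproduces all three initial values.\<close>

lemma early_breaking_time:
  assumes sol: "lagrangian_solution u0 \<mu>0 \<zeta> U h"
    and dy: "(init_y \<mu>0 has_real_derivative 1 / (1 + k\<^sup>2)) (at \<xi>)"
    and dU: "(init_U u0 \<mu>0 has_real_derivative k / (1 + k\<^sup>2)) (at \<xi>)"
    and "k < 0" "0 \<le> \<kappa>" "\<delta> \<le> 1"
    and K: "\<And>s. 0 \<le> s \<Longrightarrow> s \<le> \<delta> \<Longrightarrow> (U s \<xi>)\<^sup>2 - P_op (\<zeta> s) (U s) (h s) \<xi> \<le> 2 * \<kappa>\<^sup>2"
    and early: "2 * exp (2 * \<kappa>) / \<bar>k\<bar> \<le> \<delta>"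
  obtains t where "0 < t" "t \<le> 2 * exp (2 * \<kappa>) / \<bar>k\<bar>" "breaking_time u0 \<mu>0 \<zeta> U h t"
proof -
  define K where "K s = (U s \<xi>)\<^sup>2 - P_op (\<zeta> s) (U s) (h s) \<xi>" for s
  define p0 where "p0 = 1 / sqrt (1 + k\<^sup>2)"
  have k1: "0 < 1 + k\<^sup>2" by (rule add_pos_nonneg) auto
  have p0: "0 < p0" "p0\<^sup>2 = 1 / (1 + k\<^sup>2)" using k1 by (auto simp: p0_def power_divide)
  have "continuous_on UNIV K"
    unfolding K_def by (rule potential_continuous_in_time[OF sol])
  then obtain p r where ini: "p 0 = p0" "r 0 = k * p0"
    and dp: "\<And>t. (p has_real_derivative r t / 2) (at t)"
    and dr: "\<And>t. (r has_real_derivative K t * p t) (at t)"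
    using linear_oscillator_solution[of K p0 "k * p0"] by blast
  obtain t where t: "0 < t" "t \<le> 2 * exp (2 * \<kappa>) / \<bar>k\<bar>" "p t = 0"
    using oscillator_has_early_zero[OF _ _ \<open>k < 0\<close> dp dr \<open>0 \<le> \<kappa>\<close> _ \<open>\<delta> \<le> 1\<close> early] ini p0(1) K
    unfolding K_def by metis
  have "pointwise_solution u0 \<mu>0 \<zeta> U h \<xi> (\<lambda>s. (p s)\<^sup>2) (\<lambda>s. p s * r s) (\<lambda>s. (r s)\<^sup>2)"
    unfolding pointwise_solution_def Let_def K_def[symmetric]
  proof (intro conjI allI)
    have y0: "deriv (init_y \<mu>0) \<xi> = 1 / (1 + k\<^sup>2)" using dy by (rule DERIV_imp_deriv)
    have U0: "deriv (init_U u0 \<mu>0) \<xi> = k / (1 + k\<^sup>2)" using dU by (rule DERIV_imp_deriv)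
    show "(p 0)\<^sup>2 = deriv (init_y \<mu>0) \<xi>" by (simp add: ini p0 y0)
    show "p 0 * r 0 = deriv (init_U u0 \<mu>0) \<xi>"
    proof -
      have "p0 * (k * p0) = k * p0\<^sup>2" by (simp add: power2_eq_square)
      then show ?thesis by (simp add: ini U0 p0)
    qed
    show "(r 0)\<^sup>2 = init_h \<mu>0 \<xi>"
      using k1 by (simp add: ini init_h_def y0 power_mult_distrib p0 field_simps)
    fix s
    show "((\<lambda>s. (p s)\<^sup>2) has_real_derivative p s * r s) (at s)"
      by (rule derivative_eq_intros dp refl | simp)+
    show "((\<lambda>s. p s * r s) has_real_derivative 1/2 * (r s)\<^sup>2 + K s * (p s)\<^sup>2) (at s)"
      by (rule derivative_eq_intros dp dr refl)+ (simp add: power2_eq_square algebra_simps)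
    show "((\<lambda>s. (r s)\<^sup>2) has_real_derivative 2 * K s * (p s * r s)) (at s)"
      by (rule derivative_eq_intros dr refl | simp)+
  qed
  moreover have "init_y \<mu>0 field_differentiable at \<xi>" "init_U u0 \<mu>0 field_differentiable at \<xi>"
    using dy dU by (auto simp: field_differentiable_def)
  ultimately have "breaking_time u0 \<mu>0 \<zeta> U h t"
    using t(3) unfolding breaking_time_def by force
  then show ?thesis using that t by blast
qed

theorem theorem1p1:
  fixes q :: real
    and \<zeta> U h :: "real \<Rightarrow> real \<Rightarrow> real"
    and u :: "real \<Rightarrow> real \<Rightarrow> real" and \<mu> :: "real \<Rightarrow> real measure"
  assumes "0 < q" and "q < 1"
    and "conservative_solution (profile q) (energy_measure (profile q)) \<zeta> U h u \<mu>"
  shows "0 islimpt {t. breaking_time (profile q) (energy_measure (profile q)) \<zeta> U h t}"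
proof -
  let ?u = "profile q" and ?m = "energy_measure (profile q)"
  have sol: "lagrangian_solution ?u ?m \<zeta> U h" and fin: "finite_measure ?m"
    using assms(3) by (auto simp: conservative_solution_def calD_def)
  obtain \<delta>0 B where \<delta>0: "0 < \<delta>0" "0 \<le> B"
    "\<And>s \<xi>. \<bar>s - 0\<bar> < \<delta>0 \<Longrightarrow> (U s \<xi>)\<^sup>2 - P_op (\<zeta> s) (U s) (h s) \<xi> \<le> B\<^sup>2"
    using potential_locally_bounded_above[OF sol, of 0] by blast
  show ?thesis
    unfolding islimpt_approachable
  proof (intro allI impI)
    fix e :: real assume "0 < e"
    \<comment> \<open>the time scale: inside the region of the uniform bound, at most one, and below \<open>e\<close>\<close>
    define \<delta> where "\<delta> = min (min (\<delta>0 / 2) 1) (e / 2)"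
    have \<delta>: "0 < \<delta>" "\<delta> < \<delta>0" "\<delta> \<le> 1" "\<delta> < e" using \<delta>0(1) \<open>0 < e\<close> by (auto simp: \<delta>_def)
    \<comment> \<open>a piece of slope \<open>-q / q\<^sup>j\<close> breaks by the time \<open>2 exp (2 B) q\<^sup>j / q\<close>, which is to be below \<open>\<delta>\<close>\<close>
    obtain j where j: "q ^ j < \<delta> / (2 * exp (2 * B)) * q"
      using real_arch_pow_inv[of "\<delta> / (2 * exp (2 * B)) * q" q] \<delta> assms by auto
    define k where "k = slope q (2 * j)"
    have k: "k = - (q / q ^ j)"
      using assms by (simp add: k_def slope_def power_int_diff)
    have "k < 0" "\<bar>k\<bar> = q / q ^ j" using assms by (auto simp: k)
    have early: "2 * exp (2 * B) / \<bar>k\<bar> \<le> \<delta>"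
      using j assms by (simp add: \<open>\<bar>k\<bar> = q / q ^ j\<close> field_simps)
    have "node q (2 * j) < node q (Suc (2 * j))"
      using assms(1) by simp
    then obtain \<xi> where "(init_y ?m has_real_derivative 1 / (1 + k\<^sup>2)) (at \<xi>)"
      "(init_U ?u ?m has_real_derivative k / (1 + k\<^sup>2)) (at \<xi>)"
      using init_data_on_affine_piece[OF deriv_profile_borel[OF assms(1,2)] fin
          profile_piece[OF assms(1,2)]] unfolding k_def by metis
    moreover have "(U s \<xi>)\<^sup>2 - P_op (\<zeta> s) (U s) (h s) \<xi> \<le> 2 * B\<^sup>2" if "0 \<le> s" "s \<le> \<delta>" for s
    proof -
      have "(U s \<xi>)\<^sup>2 - P_op (\<zeta> s) (U s) (h s) \<xi> \<le> B\<^sup>2" using \<delta>0(3) that \<delta>(2) by simp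
      also have "\<dots> \<le> 2 * B\<^sup>2" by simp
      finally show ?thesis .
    qed
    ultimately obtain t where "0 < t" "t \<le> 2 * exp (2 * B) / \<bar>k\<bar>" "breaking_time ?u ?m \<zeta> U h t"
      using early_breaking_time[OF sol _ _ \<open>k < 0\<close> \<delta>0(2) \<delta>(3) _ early] by metis
    then show "\<exists>t\<in>{t. breaking_time ?u ?m \<zeta> U h t}. t \<noteq> 0 \<and> dist t 0 < e"
      using early \<delta>(4) by (intro bexI[of _ t]) (auto simp: dist_real_def)
  qed
qed

end
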